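(* Let $f,\mathcal X,\mathcal Y,\ell,D_{\mathcal Y}$ be as in the context and let $\{(x^t,y^t)\}_{t\ge0}$ be generated by Perturbed GDA with parameters $r_y^t>0$, $\alpha^t$, $c^t$ satisfying, for all $t\ge 0$, $$\alpha^t=\Theta\Big(\tfrac1\ell\Big),\quad 0<\alpha^t\le\frac{1}{4(\ell+r_y^t)},\qquad c^t=\Theta\Big(\tfrac{(r_y^t)^2}{\ell^3}\Big),\quad 0<c^t\le\min\Big\{\frac{(r_y^t)^2\alpha^t}{16\ell^2},\frac{r_y^t}{\ell(3r_y^t+2\ell)},\frac{3r_y^t}{128\ell^2}\Big\}.$$ Given any $\epsilon>0$: (i) (Game stationarity) If $r_y^t=r_y$ for all $t\ge0$ with $r_y=\Theta(\epsilon/D_{\mathcal Y})$, then there exists an index $t\le O\big(\ell^3D_{\mathcal Y}^2\Delta_{\Psi_1}/\epsilon^4\big)$ such that $(x^{t+1},y^{t+1})$ is an $\epsilon$-GS of the problem $\min_{x\in\mathcal X}\max_{y\in\mathcal Y}f(x,y)$. (ii) (Optimization stationarity) If $r_y^t=r_y$ for all $t\ge0$ with $r_y=\Theta\big(\epsilon^2/(\ell D_{\mathcal Y}^2)\big)$, then there exists an index $t\le O\big(\ell^5D_{\mathcal Y}^4\Delta_{\Psi_1}/\epsilon^6\big)$ such that $x^{t+1}$ is an $\epsilon$-OS of the problem $\min_{x\in\mathcal X}\max_{y\in\mathcal Y}f(x,y)$.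
   Context: Setting: $f:\mathbb R^n\times\mathbb R^d\to\mathbb R$; $\mathcal X\subseteq\mathbb R^n$ is nonempty, closed and convex; $\mathcal Y\subseteq\mathbb R^d$ is nonempty, compact and convex with $0\in\mathcal Y$ and diameter $D_{\mathcal Y}>0$. The function $f$ is continuously differentiable and $\ell$-smooth ($\ell>0$): for all $x,x'\in\mathcal X$, $y,y'\in\mathcal Y$, both $\|\nabla_xf(x,y)-\nabla_xf(x',y')\|$ and $\|\nabla_yf(x,y)-\nabla_yf(x',y')\|$ are at most $\ell(\|x-x'\|+\|y-y'\|)$. For each $x\in\mathcal X$, $f(x,\cdot)$ is concave. Stationarity: $\iota_S$ is the indicator function of a set $S$ ($0$ on $S$, $+\infty$ outside), and $\partial\iota_S$ its subdifferential. A pair $(x,y)\in\mathcal X\times\mathcal Y$ is an $\epsilon$-game-stationary point ($\epsilon$-GS) if $\mathrm{dist}(0,\nabla_xf(x,y)+\partial\iota_{\mathcal X}(x))\le\epsilon$ and $\mathrm{dist}(0,-\nabla_yf(x,y)+\partial\iota_{\mathcal Y}(y))\le\epsilon$. Let $\Phi(x)=\max_{y'\in\mathcal Y}f(x,y')+\iota_{\mathcal X}(x)$. A point $x\in\mathcal X$ is an $\epsilon$-optimization-stationary point ($\epsilon$-OS) if $\|\mathrm{prox}_{\frac{1}{2\ell}\Phi}(x)-x\|\le\frac{\epsilon}{2\ell}$, where $\mathrm{prox}_{\frac1{2\ell}\Phi}(x)=\arg\min_{w}\{\Phi(w)+\ell\|w-x\|^2\}$. Perturbed GDA: let $f_t(x,y)=f(x,y)-\frac{r_y^t}{2}\|y\|^2$.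 From an initial point $(x^0,y^0)\in\mathcal X\times\mathcal Y$, iterate for $t=0,1,\dots$ $$x^{t+1}=\mathrm{proj}_{\mathcal X}(x^t-c^t\nabla_xf_t(x^t,y^t)),\qquad y^{t+1}=\mathrm{proj}_{\mathcal Y}(y^t+\alpha^t\nabla_yf_t(x^{t+1},y^t)).$$ Initial gap: $\Delta_{\Psi_1}=\Psi_1^0(x^0,y^0)-\min_{x\in\mathcal X}\max_{y\in\mathcal Y}f_0(x,y)$, where $\Psi_1^0(x,y)=2\max_{y'\in\mathcal Y}f_0(x,y')-f_0(x,y)$; it is understood to be a finite number. Conventions: $\epsilon\in(0,1)$ is a sufficiently small positive number. $O$ and $\Theta$ hide positive constants not depending on $\epsilon$, $\ell$, $D_{\mathcal Y}$, $\Delta_{\Psi_1}$ or the iteration index.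
   Formalization: The hidden upper constant in r_y = Θ(ε/D_Y), respectively r_y = Θ(ε²/(ℓ D_Y²)), is required to lie below some absolute positive threshold, since the claim fails for large constants. *)

theory Defs
  imports "HOL-Analysis.Analysis"
begin

definition grad :: "('a::euclidean_space \<Rightarrow> real) \<Rightarrow> 'a \<Rightarrow> 'a" where
  "grad g x = (THE v. GDERIV g x :> v)"

definition grad_x ::
  "('a::euclidean_space \<Rightarrow> 'b::euclidean_space \<Rightarrow> real) \<Rightarrow> 'a \<Rightarrow> 'b \<Rightarrow> 'a" where
  "grad_x f x y = grad (\<lambda>u. f u y) x"

definition grad_y ::
  "('a::euclidean_space \<Rightarrow> 'b::euclidean_space \<Rightarrow> real) \<Rightarrow> 'a \<Rightarrow> 'b \<Rightarrow> 'b" where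
  "grad_y f x y = grad (f x) y"

text \<open>The differentiability clauses refer to the joint function on the product space, and hold
  on the whole space, whereas smoothness and concavity are only required on \<open>X\<close> and \<open>Y\<close>.\<close>

locale minimax_problem =
  fixes f :: "'a::euclidean_space \<Rightarrow> 'b::euclidean_space \<Rightarrow> real"
    and X :: "'a set" and Y :: "'b set" and L :: real
  assumes X_nonempty: "X \<noteq> {}" and X_closed: "closed X" and X_convex: "convex X"
    and Y_nonempty: "Y \<noteq> {}" and Y_compact: "compact Y" and Y_convex: "convex Y"
    and Y_zero: "0 \<in> Y" and Y_diameter: "diameter Y > 0"
    and L_pos: "L > 0"
    and f_differentiable: "\<And>z. (\<lambda>(x, y). f x y) differentiable (at z)"
    and f_grad_continuous: "continuous_on UNIV (grad (\<lambda>(x, y). f x y))"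
    and grad_x_smooth: "\<And>x x' y y'. \<lbrakk>x \<in> X; x' \<in> X; y \<in> Y; y' \<in> Y\<rbrakk> \<Longrightarrow>
      norm (grad_x f x y - grad_x f x' y') \<le> L * (norm (x - x') + norm (y - y'))"
    and grad_y_smooth: "\<And>x x' y y'. \<lbrakk>x \<in> X; x' \<in> X; y \<in> Y; y' \<in> Y\<rbrakk> \<Longrightarrow>
      norm (grad_y f x y - grad_y f x' y') \<le> L * (norm (x - x') + norm (y - y'))"
    and f_concave: "\<And>x. x \<in> X \<Longrightarrow> concave_on Y (f x)"

definition indicator_fun :: "'a set \<Rightarrow> 'a \<Rightarrow> ereal" where
  "indicator_fun S x = (if x \<in> S then 0 else \<infinity>)"

definition subdifferential :: "('a::euclidean_space \<Rightarrow> ereal) \<Rightarrow> 'a \<Rightarrow> 'a set" where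
  "subdifferential \<phi> x =
     {v. \<bar>\<phi> x\<bar> \<noteq> \<infinity> \<and> (\<forall>z. \<phi> z \<ge> \<phi> x + ereal (v \<bullet> (z - x)))}"

text \<open>In the following definition the sets whose distance to \<open>0\<close> is taken are nonempty, since
  \<open>0\<close> is a subgradient of the indicator function of a set at each of its points. Hence the
  convention that \<open>infdist\<close> to the empty set is \<open>0\<close> plays no role.\<close>

definition game_stationary ::
  "('a::euclidean_space \<Rightarrow> 'b::euclidean_space \<Rightarrow> real) \<Rightarrow> 'a set \<Rightarrow> 'b set \<Rightarrow> real \<Rightarrow> 'a \<Rightarrow> 'b \<Rightarrow> bool"
where
  "game_stationary f X Y \<epsilon> x y \<longleftrightarrow> x \<in> X \<and> y \<in> Y \<and>
     infdist 0 ((\<lambda>v. grad_x f x y + v) ` subdifferential (indicator_fun X) x) \<le> \<epsilon> \<and>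
     infdist 0 ((\<lambda>v. - grad_y f x y + v) ` subdifferential (indicator_fun Y) y) \<le> \<epsilon>"

definition primal ::
  "('a \<Rightarrow> 'b \<Rightarrow> real) \<Rightarrow> 'a set \<Rightarrow> 'b set \<Rightarrow> 'a \<Rightarrow> ereal" where
  "primal f X Y x = ereal (SUP y\<in>Y. f x y) + indicator_fun X x"

text \<open>\<open>prox \<tau> \<phi>\<close> is the proximal map of \<open>\<tau>\<phi>\<close>; for \<open>\<tau> = 1 / (2 * L)\<close> the quadratic term is
  \<open>L * (norm (w - x))\<^sup>2\<close>.\<close>

definition prox :: "real \<Rightarrow> ('a::euclidean_space \<Rightarrow> ereal) \<Rightarrow> 'a \<Rightarrow> 'a" where
  "prox \<tau> \<phi> x = arg_min (\<lambda>w. \<phi> w + ereal ((norm (w - x))\<^sup>2 / (2 * \<tau>))) (\<lambda>_. True)"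

definition optimization_stationary ::
  "('a::euclidean_space \<Rightarrow> 'b::euclidean_space \<Rightarrow> real) \<Rightarrow> 'a set \<Rightarrow> 'b set \<Rightarrow> real \<Rightarrow> real \<Rightarrow> 'a \<Rightarrow> bool"
where
  "optimization_stationary f X Y L \<epsilon> x \<longleftrightarrow>
     x \<in> X \<and> norm (prox (1 / (2 * L)) (primal f X Y) x - x) \<le> \<epsilon> / (2 * L)"

definition perturbed :: "('a \<Rightarrow> 'b::euclidean_space \<Rightarrow> real) \<Rightarrow> real \<Rightarrow> 'a \<Rightarrow> 'b \<Rightarrow> real" where
  "perturbed f r x y = f x y - r / 2 * (norm y)\<^sup>2"

definition perturbed_gda ::
  "('a::euclidean_space \<Rightarrow> 'b::euclidean_space \<Rightarrow> real) \<Rightarrow> 'a set \<Rightarrow> 'b set \<Rightarrow>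
   (nat \<Rightarrow> real) \<Rightarrow> (nat \<Rightarrow> real) \<Rightarrow> (nat \<Rightarrow> real) \<Rightarrow> (nat \<Rightarrow> 'a) \<Rightarrow> (nat \<Rightarrow> 'b) \<Rightarrow> bool"
where
  "perturbed_gda f X Y r \<alpha> c x y \<longleftrightarrow> x 0 \<in> X \<and> y 0 \<in> Y \<and>
     (\<forall>t. x (Suc t) = closest_point X (x t - c t *\<^sub>R grad_x (perturbed f (r t)) (x t) (y t)) \<and>
          y (Suc t) = closest_point Y (y t + \<alpha> t *\<^sub>R grad_y (perturbed f (r t)) (x (Suc t)) (y t)))"

definition Psi1 ::
  "('a \<Rightarrow> 'b::euclidean_space \<Rightarrow> real) \<Rightarrow> 'b set \<Rightarrow> real \<Rightarrow> 'a \<Rightarrow> 'b \<Rightarrow> real" where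
  "Psi1 f Y r x y = 2 * (SUP y'\<in>Y. perturbed f r x y') - perturbed f r x y"

text \<open>The minimum over \<open>X\<close> is rendered as an infimum, so that it need not be attained.
  \<open>finite_gap\<close> says that this infimum, and hence the initial gap, is a finite number.\<close>

definition finite_gap ::
  "('a \<Rightarrow> 'b::euclidean_space \<Rightarrow> real) \<Rightarrow> 'a set \<Rightarrow> 'b set \<Rightarrow> real \<Rightarrow> bool" where
  "finite_gap f X Y r0 \<longleftrightarrow> bdd_below ((\<lambda>x. SUP y\<in>Y. perturbed f r0 x y) ` X)"

definition initial_gap ::
  "('a \<Rightarrow> 'b::euclidean_space \<Rightarrow> real) \<Rightarrow> 'a set \<Rightarrow> 'b set \<Rightarrow> real \<Rightarrow> 'a \<Rightarrow> 'b \<Rightarrow> real" where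
  "initial_gap f X Y r0 x0 y0 =
     Psi1 f Y r0 x0 y0 - (INF x\<in>X. SUP y\<in>Y. perturbed f r0 x y)"

text \<open>\<open>u = \<Theta>(v)\<close> with explicit implied constants; these are quantified before all problem data.\<close>

definition theta_with :: "real \<Rightarrow> real \<Rightarrow> real \<Rightarrow> real \<Rightarrow> bool" where
  "theta_with lo hi u v \<longleftrightarrow> lo * v \<le> u \<and> u \<le> hi * v"

definition gda_parameters ::
  "real \<Rightarrow> real \<Rightarrow> real \<Rightarrow> real \<Rightarrow> real \<Rightarrow> (nat \<Rightarrow> real) \<Rightarrow> (nat \<Rightarrow> real) \<Rightarrow> (nat \<Rightarrow> real) \<Rightarrow> bool"
where
  "gda_parameters a1 a2 b1 b2 L r \<alpha> c \<longleftrightarrow>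
     (\<forall>t. r t > 0 \<and>
          theta_with a1 a2 (\<alpha> t) (1 / L) \<and>
          0 < \<alpha> t \<and> \<alpha> t \<le> 1 / (4 * (L + r t)) \<and>
          theta_with b1 b2 (c t) ((r t)\<^sup>2 / L ^ 3) \<and>
          0 < c t \<and>
          c t \<le> min ((r t)\<^sup>2 * \<alpha> t / (16 * L\<^sup>2))
                 (min (r t / (L * (3 * r t + 2 * L))) (3 * r t / (128 * L\<^sup>2))))"

end

theory Submission
  imports Defs
begin

text \<open>
  The regularization makes the inner problem strongly concave, so a projected ascent step from \<open>y\<close>
  bounds the distance of \<open>y\<close> to the inner maximizer. With the prescribed step sizes this error is
  absorbed by the descent terms, and the Lyapunov function \<open>2 \<Phi> - f\<close> decreases in each iteration by
  at least \<open>\<bar>x' - x\<bar>\<^sup>2 / (8 c) + \<bar>y' - y\<bar>\<^sup>2 / (2 \<alpha>)\<close>. Telescoping makes one step small, and a small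
  step has small stationarity residuals for \<open>f\<close>, up to a perturbation of size \<open>r D\<close> in the dual
  part. For optimization stationarity, the dual residual times \<open>D\<close> bounds the inner duality gap, and
  weak convexity of \<open>\<Phi>\<close> turns that gap together with the primal residual into a bound on the
  distance to the proximal point.
\<close>

subsection \<open>Gradients on convex sets\<close>

lemma GDERIV_unique:
  fixes g :: "'a::euclidean_space \<Rightarrow> real"
  assumes "GDERIV g x :> v" "GDERIV g x :> w"
  shows "v = w"
proof -
  have "(\<lambda>h. h \<bullet> v) = (\<lambda>h. h \<bullet> w)"
    using assms has_derivative_unique unfolding gderiv_def by blast
  then show ?thesis
    by (metis vector_eq_ldot)
qed

lemma grad_eq:
  assumes "GDERIV g x :> v"
  shows "grad g x = v"
  unfolding grad_def using assms GDERIV_unique by blast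

lemma GDERIV_grad:
  assumes "g differentiable (at x)"
  shows "GDERIV g x :> grad g x"
proof -
  obtain g' where g': "(g has_derivative g') (at x)"
    using assms unfolding differentiable_def by blast
  then have "linear g'"
    by (rule has_derivative_linear)
  \<comment> \<open>For a real-valued linear map, the adjoint applied to \<open>1\<close> is the
    Riesz vector that represents it.\<close>
  then have "g' = (\<lambda>h. h \<bullet> adjoint g' 1)"
    using adjoint_works[of g' _ 1] by (intro ext) (simp del: adjoint_adjoint)
  with g' have "GDERIV g x :> adjoint g' 1"
    unfolding gderiv_def by (rule has_derivative_eq_rhs)
  then show ?thesis
    using grad_eq by metis
qed

lemma segment_mem:
  assumes "convex S" "u \<in> S" "v \<in> S" "0 \<le> t" "t \<le> 1"
  shows "u + t *\<^sub>R (v - u) \<in> S"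
  using convexD_alt[OF assms] by (simp add: algebra_simps)

lemma DERIV_segment:
  assumes "g differentiable (at (u + t *\<^sub>R d))"
  shows "((\<lambda>t. g (u + t *\<^sub>R d)) has_real_derivative (grad g (u + t *\<^sub>R d) \<bullet> d)) (at t)"
proof -
  have "(g has_derivative (\<lambda>h. h \<bullet> grad g (u + t *\<^sub>R d))) (at (u + t *\<^sub>R d))"
    using GDERIV_grad[OF assms] unfolding gderiv_def .
  moreover have "((\<lambda>t. u + t *\<^sub>R d) has_derivative (\<lambda>h. h *\<^sub>R d)) (at t)"
    by (auto intro!: derivative_eq_intros)
  ultimately have "((\<lambda>t. g (u + t *\<^sub>R d)) has_derivative (\<lambda>h. (h *\<^sub>R d) \<bullet> grad g (u + t *\<^sub>R d))) (at t)"
    using has_derivative_compose by blast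
  moreover have "(\<lambda>h. (h *\<^sub>R d) \<bullet> grad g (u + t *\<^sub>R d)) = (*) (grad g (u + t *\<^sub>R d) \<bullet> d)"
    by (auto simp: inner_commute)
  ultimately show ?thesis
    by (simp add: has_field_derivative_def)
qed

text \<open>The descent lemma, proved by monotonicity along the segment from \<open>u\<close> to
  \<open>v\<close> instead of integration. Gradients are compared with the one at \<open>u\<close>
  only, and only on \<open>S\<close>, which fits smoothness on \<open>X\<close> and
  \<open>Y\<close>.\<close>

lemma lipschitz_gradient_upper_bound:
  assumes "convex S" "u \<in> S" "v \<in> S" "\<And>w. w \<in> S \<Longrightarrow> g differentiable (at w)"
    and lip: "\<And>w. w \<in> S \<Longrightarrow> norm (grad g w - grad g u) \<le> M * norm (w - u)"
  shows "g v \<le> g u + grad g u \<bullet> (v - u) + M / 2 * (norm (v - u))\<^sup>2"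
proof -
  define d where "d = v - u"
  \<comment> \<open>\<open>\<phi>\<close> is \<open>g\<close> along the segment minus the linear and
    quadratic terms of the claimed bound, so the claim is exactly
    \<open>\<phi> 1 \<le> \<phi> 0\<close>.\<close>
  define \<phi> where "\<phi> t = g (u + t *\<^sub>R d) - t * (grad g u \<bullet> d) - M / 2 * t\<^sup>2 * (norm d)\<^sup>2" for t
  have "\<phi> 1 \<le> \<phi> 0"
  proof (rule DERIV_nonpos_imp_nonincreasing[of 0 1 \<phi>])
    fix t :: real assume t: "0 \<le> t" "t \<le> 1"
    let ?w = "u + t *\<^sub>R d"
    have w: "?w \<in> S"
      unfolding d_def using segment_mem assms t by blast
    have "(\<phi> has_real_derivative (grad g ?w \<bullet> d - grad g u \<bullet> d - M * t * (norm d)\<^sup>2)) (at t)"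
      unfolding \<phi>_def
      by (rule derivative_eq_intros DERIV_segment assms(4) w refl | simp)+
    moreover have "(grad g ?w - grad g u) \<bullet> d \<le> M * t * (norm d)\<^sup>2"
    proof -
      have "(grad g ?w - grad g u) \<bullet> d \<le> norm (grad g ?w - grad g u) * norm d"
        by (rule norm_cauchy_schwarz)
      also have "\<dots> \<le> (M * norm (?w - u)) * norm d"
        using lip[OF w] by (rule mult_right_mono) simp
      finally show ?thesis
        using t by (simp add: power2_eq_square mult.assoc)
    qed
    ultimately show "\<exists>D. (\<phi> has_real_derivative D) (at t) \<and> D \<le> 0"
      by (force simp: inner_diff_left)
  qed simp
  then show ?thesis
    by (simp add: \<phi>_def d_def)
qed

lemma grad_uminus:
  assumes "g differentiable (at x)"
  shows "grad (\<lambda>u. - g u) x = - grad g x"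
  using GDERIV_minus[OF GDERIV_grad[OF assms]] by (rule grad_eq)

lemma lipschitz_gradient_lower_bound:
  assumes "convex S" "u \<in> S" "v \<in> S" "\<And>w. w \<in> S \<Longrightarrow> g differentiable (at w)"
    and lip: "\<And>w. w \<in> S \<Longrightarrow> norm (grad g w - grad g u) \<le> M * norm (w - u)"
  shows "g v \<ge> g u + grad g u \<bullet> (v - u) - M / 2 * (norm (v - u))\<^sup>2"
proof -
  have "- g v \<le> - g u + grad (\<lambda>u. - g u) u \<bullet> (v - u) + M / 2 * (norm (v - u))\<^sup>2"
  proof (rule lipschitz_gradient_upper_bound[OF assms(1-3)])
    fix w assume w: "w \<in> S"
    show "(\<lambda>u. - g u) differentiable at w"
      using assms(4)[OF w] by simp
    show "norm (grad (\<lambda>u. - g u) w - grad (\<lambda>u. - g u) u) \<le> M * norm (w - u)"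
      using lip[OF w] assms(2,4) w by (simp add: grad_uminus norm_minus_commute)
  qed
  then show ?thesis
    using assms(2,4) by (simp add: grad_uminus)
qed

text \<open>The limit is one-sided because a convex set contains the points
  \<open>u + t *\<^sub>R (v - u)\<close> only for \<open>t\<close> in the unit interval.\<close>

lemma segment_slope_tendsto:
  assumes "g differentiable (at u)"
  shows "((\<lambda>t. (g (u + t *\<^sub>R d) - g u) / t) \<longlongrightarrow> grad g u \<bullet> d) (at_right 0)"
proof -
  have "((\<lambda>t. g (u + t *\<^sub>R d)) has_real_derivative (grad g u \<bullet> d)) (at 0)"
    using DERIV_segment[of g u 0 d] assms by simp
  then have "((\<lambda>t. (g (u + t *\<^sub>R d) - g u) / t) \<longlongrightarrow> grad g u \<bullet> d) (at 0)"
    by (simp add: DERIV_def)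
  then show ?thesis
    by (rule filterlim_mono) (auto simp: at_le)
qed

text \<open>Concavity bounds \<open>g v - g u\<close> by every secant slope at \<open>u\<close>
  towards \<open>v\<close>, and these slopes tend to the directional derivative.\<close>

lemma concave_on_le_tangent:
  assumes "concave_on S g" "u \<in> S" "v \<in> S" "g differentiable (at u)"
  shows "g v \<le> g u + grad g u \<bullet> (v - u)"
proof -
  have "eventually (\<lambda>t. g v - g u \<le> (g (u + t *\<^sub>R (v - u)) - g u) / t) (at_right 0)"
    unfolding eventually_at_right_field
  proof (intro exI[of _ 1] conjI allI impI)
    fix t :: real assume t: "0 < t" "t < 1"
    have "g ((1 - t) *\<^sub>R u + t *\<^sub>R v) \<ge> (1 - t) * g u + t * g v"
      using assms(1-3) t by (intro concave_onD) auto
    then have "t * (g v - g u) \<le> g (u + t *\<^sub>R (v - u)) - g u"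
      by (simp add: algebra_simps)
    then show "g v - g u \<le> (g (u + t *\<^sub>R (v - u)) - g u) / t"
      using t by (simp add: field_simps)
  qed simp
  then have "g v - g u \<le> grad g u \<bullet> (v - u)"
    using tendsto_lowerbound[OF segment_slope_tendsto[OF assms(4)]] by simp
  then show ?thesis
    by simp
qed

lemma maximizer_variational_inequality:
  assumes "convex S" "u \<in> S" "v \<in> S" "\<And>w. w \<in> S \<Longrightarrow> g w \<le> g u" "g differentiable (at u)"
  shows "grad g u \<bullet> (v - u) \<le> 0"
proof -
  have "eventually (\<lambda>t. (g (u + t *\<^sub>R (v - u)) - g u) / t \<le> 0) (at_right 0)"
    unfolding eventually_at_right_field
  proof (intro exI[of _ 1] conjI allI impI)
    fix t :: real assume t: "0 < t" "t < 1"
    have "g (u + t *\<^sub>R (v - u)) \<le> g u"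
      using assms t by (intro assms(4) segment_mem) auto
    then show "(g (u + t *\<^sub>R (v - u)) - g u) / t \<le> 0"
      using t by (simp add: divide_nonpos_pos)
  qed simp
  then show ?thesis
    using tendsto_upperbound[OF segment_slope_tendsto[OF assms(5)]] by simp
qed

text \<open>A vector \<open>v\<close> with this inequality lies in the normal cone of
  \<open>S\<close> at \<open>u\<close>, which is the subdifferential of the indicator function. Any
  such vector therefore certifies a bound on the stationarity measure.\<close>

lemma infdist_normal_cone_le:
  assumes "u \<in> S" "\<And>z. z \<in> S \<Longrightarrow> v \<bullet> (z - u) \<le> 0"
  shows "infdist 0 ((\<lambda>v. a + v) ` subdifferential (indicator_fun S) u) \<le> norm (a + v)"
proof -
  have "v \<in> subdifferential (indicator_fun S) u"
    using assms by (auto simp: subdifferential_def indicator_fun_def)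
  then have "infdist 0 ((\<lambda>v. a + v) ` subdifferential (indicator_fun S) u) \<le> dist 0 (a + v)"
    by (intro infdist_le) simp
  then show ?thesis
    by simp
qed

subsection \<open>The regularized problem\<close>

text \<open>Lets the bounds for the regularized function be reused for \<open>f\<close> itself by
  taking \<open>r = 0\<close>.\<close>

lemma perturbed_zero [simp]: "perturbed f 0 = f"
  by (simp add: perturbed_def fun_eq_iff)

context minimax_problem
begin

lemma Y_closed: "closed Y"
  using Y_compact by (rule compact_imp_closed)

lemma differentiable_fst: "(\<lambda>u. f u y) differentiable (at x)"
proof -
  obtain f' where "((\<lambda>(x, y). f x y) has_derivative f') (at (x, y))"
    using f_differentiable unfolding differentiable_def by blast
  moreover have "((\<lambda>u. (u, y)) has_derivative (\<lambda>h. (h, 0))) (at x)"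
    by (auto intro!: derivative_eq_intros)
  ultimately have "((\<lambda>u. case (u, y) of (x, y) \<Rightarrow> f x y) has_derivative (\<lambda>h. f' (h, 0))) (at x)"
    by (rule has_derivative_compose[rotated])
  then show ?thesis
    by (auto simp: differentiable_def)
qed

lemma differentiable_snd: "f x differentiable (at y)"
proof -
  obtain f' where "((\<lambda>(x, y). f x y) has_derivative f') (at (x, y))"
    using f_differentiable unfolding differentiable_def by blast
  moreover have "((\<lambda>u. (x, u)) has_derivative (\<lambda>h. (0, h))) (at y)"
    by (auto intro!: derivative_eq_intros)
  ultimately have "((\<lambda>u. case (x, u) of (x, y) \<Rightarrow> f x y) has_derivative (\<lambda>h. f' (0, h))) (at y)"
    by (rule has_derivative_compose[rotated])
  then show ?thesis
    by (auto simp: differentiable_def)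
qed

lemma GDERIV_perturbed_fst: "GDERIV (\<lambda>u. perturbed f r u y) x :> grad_x f x y"
  using GDERIV_diff[OF GDERIV_grad[OF differentiable_fst] GDERIV_const]
  by (simp add: perturbed_def grad_x_def)

lemma GDERIV_perturbed_snd: "GDERIV (perturbed f r x) y :> grad_y f x y - r *\<^sub>R y"
proof -
  have "GDERIV (\<lambda>y. r / 2 * (norm y)\<^sup>2) y :> r *\<^sub>R y"
    unfolding gderiv_def power2_norm_eq_inner
    by (auto intro!: derivative_eq_intros simp: inner_commute fun_eq_iff)
  then show ?thesis
    using GDERIV_diff[OF GDERIV_grad[OF differentiable_snd]]
    by (simp add: perturbed_def[abs_def] grad_y_def)
qed

lemma grad_perturbed_fst [simp]: "grad (\<lambda>u. perturbed f r u y) x = grad_x f x y"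
  using GDERIV_perturbed_fst by (rule grad_eq)

lemma grad_perturbed_snd [simp]: "grad (perturbed f r x) y = grad_y f x y - r *\<^sub>R y"
  using GDERIV_perturbed_snd by (rule grad_eq)

lemma grad_x_perturbed [simp]: "grad_x (perturbed f r) x y = grad_x f x y"
  by (simp add: grad_x_def[of "perturbed f r"])

lemma grad_y_perturbed [simp]: "grad_y (perturbed f r) x y = grad_y f x y - r *\<^sub>R y"
  by (simp add: grad_y_def[of "perturbed f r"])

lemma perturbed_differentiable_fst: "(\<lambda>u. perturbed f r u y) differentiable (at x)"
  using GDERIV_perturbed_fst unfolding gderiv_def differentiable_def by blast

lemma perturbed_differentiable_snd: "perturbed f r x differentiable (at y)"
  using GDERIV_perturbed_snd unfolding gderiv_def differentiable_def by blast

lemma perturbed_upper_bound_fst: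
  assumes "x \<in> X" "x' \<in> X" "y \<in> Y"
  shows "perturbed f r x' y \<le> perturbed f r x y + grad_x f x y \<bullet> (x' - x) + L / 2 * (norm (x' - x))\<^sup>2"
  using lipschitz_gradient_upper_bound[OF X_convex assms(1,2), of "\<lambda>u. perturbed f r u y" L]
    perturbed_differentiable_fst grad_x_smooth[of _ x y y] assms by simp

lemma perturbed_lower_bound_fst:
  assumes "x \<in> X" "x' \<in> X" "y \<in> Y"
  shows "perturbed f r x' y \<ge> perturbed f r x y + grad_x f x y \<bullet> (x' - x) - L / 2 * (norm (x' - x))\<^sup>2"
  using lipschitz_gradient_lower_bound[OF X_convex assms(1,2), of "\<lambda>u. perturbed f r u y" L]
    perturbed_differentiable_fst grad_x_smooth[of _ x y y] assms by simp

lemma grad_y_perturbed_lipschitz: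
  assumes "x \<in> X" "y \<in> Y" "y' \<in> Y" "r \<ge> 0"
  shows "norm ((grad_y f x y' - r *\<^sub>R y') - (grad_y f x y - r *\<^sub>R y)) \<le> (L + r) * norm (y' - y)"
proof -
  have "(grad_y f x y' - r *\<^sub>R y') - (grad_y f x y - r *\<^sub>R y) =
      (grad_y f x y' - grad_y f x y) - r *\<^sub>R (y' - y)"
    by (simp add: algebra_simps)
  also have "norm \<dots> \<le> norm (grad_y f x y' - grad_y f x y) + norm (r *\<^sub>R (y' - y))"
    by (rule norm_triangle_ineq4)
  also have "\<dots> \<le> L * norm (y' - y) + r * norm (y' - y)"
    using grad_y_smooth[of x x y' y] assms by simp
  finally show ?thesis
    by (simp add: algebra_simps)
qed

lemma perturbed_lower_bound_snd:
  assumes "x \<in> X" "y \<in> Y" "y' \<in> Y" "r \<ge> 0"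
  shows "perturbed f r x y' \<ge> perturbed f r x y + (grad_y f x y - r *\<^sub>R y) \<bullet> (y' - y)
    - (L + r) / 2 * (norm (y' - y))\<^sup>2"
  using lipschitz_gradient_lower_bound[OF Y_convex assms(2,3), of "perturbed f r x" "L + r"]
    perturbed_differentiable_snd grad_y_perturbed_lipschitz[OF assms(1,2) _ assms(4)] by simp

text \<open>Adding the tangent inequalities of the concave function \<open>f x\<close> at
  \<open>y\<close> and at \<open>y'\<close> makes its gradient monotone; the regularization
  contributes the quadratic term exactly.\<close>

lemma perturbed_grad_y_strongly_monotone:
  assumes "x \<in> X" "y \<in> Y" "y' \<in> Y"
  shows "((grad_y f x y - r *\<^sub>R y) - (grad_y f x y' - r *\<^sub>R y')) \<bullet> (y - y') \<le> - r * (norm (y - y'))\<^sup>2"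
proof -
  have "f x y' \<le> f x y + grad_y f x y \<bullet> (y' - y)" "f x y \<le> f x y' + grad_y f x y' \<bullet> (y - y')"
    unfolding grad_y_def
    by (rule concave_on_le_tangent[OF f_concave]; use assms differentiable_snd in simp)+
  then have "(grad_y f x y - grad_y f x y') \<bullet> (y - y') \<le> 0"
    by (simp add: inner_diff)
  then show ?thesis
    by (simp add: power2_norm_eq_inner inner_diff inner_commute algebra_simps)
qed

lemma continuous_joint: "continuous_on S (\<lambda>(x, y). f x y)"
  using f_differentiable differentiable_imp_continuous_within
  by (metis continuous_at_imp_continuous_on)

lemma continuous_perturbed_snd: "continuous_on Y (perturbed f r x)"
  using perturbed_differentiable_snd differentiable_imp_continuous_within
  by (metis continuous_at_imp_continuous_on)

lemma SUP_perturbed_attained: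
  obtains y where "y \<in> Y" "(SUP y\<in>Y. perturbed f r x y) = perturbed f r x y"
    "\<And>y'. y' \<in> Y \<Longrightarrow> perturbed f r x y' \<le> perturbed f r x y"
proof -
  obtain y where y: "y \<in> Y" "\<forall>y'\<in>Y. perturbed f r x y' \<le> perturbed f r x y"
    using continuous_attains_sup[OF Y_compact Y_nonempty continuous_perturbed_snd] by blast
  then have "(SUP y\<in>Y. perturbed f r x y) = perturbed f r x y"
    by (intro cSup_eq_maximum) auto
  then show thesis
    using that y by blast
qed

lemma perturbed_le_SUP: "y \<in> Y \<Longrightarrow> perturbed f r x y \<le> (SUP y\<in>Y. perturbed f r x y)"
  by (metis SUP_perturbed_attained)

text \<open>Strong concavity turns the length of one projected ascent step into a bound on the
  distance from \<open>y\<close> to the inner maximizer \<open>ys\<close>. The factor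
  \<open>1 / r\<close> in it is the reason why \<open>c\<close> has to be of order
  \<open>r\<^sup>2\<close>.\<close>

lemma projected_step_error_bound:
  assumes "r > 0" "0 < \<alpha>" "\<alpha> \<le> 1 / (4 * (L + r))" "x \<in> X" "y \<in> Y" "ys \<in> Y"
    and max: "\<And>y'. y' \<in> Y \<Longrightarrow> perturbed f r x y' \<le> perturbed f r x ys"
    and y': "y' = closest_point Y (y + \<alpha> *\<^sub>R (grad_y f x y - r *\<^sub>R y))"
  shows "norm (y - ys) \<le> 5 / (4 * (\<alpha> * r)) * norm (y' - y)"
proof -
  define G where "G z = grad_y f x z - r *\<^sub>R z" for z
  define u e where "u = y - ys" and "e = y' - y"
  have y'Y: "y' \<in> Y"
    unfolding y' using Y_closed Y_nonempty by (rule closest_point_in_set)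
  have \<alpha>L: "\<alpha> * (L + r) \<le> 1 / 4"
    using assms(1-3) L_pos by (simp add: field_simps)
  \<comment> \<open>The projection inequality is tested at \<open>ys\<close>, and below the
    optimality of \<open>ys\<close> is tested at \<open>y'\<close>. Both involve the direction
    \<open>u + e = y' - ys\<close>, so together they leave only the difference
    \<open>G y - G ys\<close>.\<close>
  have "(y + \<alpha> *\<^sub>R G y - y') \<bullet> (ys - y') \<le> 0"
    unfolding y' G_def using closest_point_dot[OF Y_convex Y_closed assms(6)] .
  then have 1: "e \<bullet> u + (norm e)\<^sup>2 - \<alpha> * (G y \<bullet> (u + e)) \<le> 0"
    by (simp add: u_def e_def power2_norm_eq_inner algebra_simps inner_commute)
  have "G ys \<bullet> (y' - ys) \<le> 0"
    using maximizer_variational_inequality[OF Y_convex assms(6) y'Y max perturbed_differentiable_snd]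
    by (simp add: G_def)
  then have "\<alpha> * (G ys \<bullet> (u + e)) \<le> 0"
    using assms(2) by (simp add: u_def e_def mult_nonneg_nonpos)
  with 1 have 2: "e \<bullet> u + (norm e)\<^sup>2 \<le> \<alpha> * ((G y - G ys) \<bullet> u) + \<alpha> * ((G y - G ys) \<bullet> e)"
    by (simp add: algebra_simps)
  have "\<alpha> * ((G y - G ys) \<bullet> u) \<le> \<alpha> * (- r * (norm u)\<^sup>2)"
    unfolding G_def u_def
    using perturbed_grad_y_strongly_monotone[OF assms(4-6)] assms(2) by (intro mult_left_mono) auto
  moreover have "\<alpha> * ((G y - G ys) \<bullet> e) \<le> 1 / 4 * (norm u * norm e)"
  proof -
    have "(G y - G ys) \<bullet> e \<le> norm (G y - G ys) * norm e"
      by (rule norm_cauchy_schwarz)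
    also have "\<dots> \<le> ((L + r) * norm u) * norm e"
      unfolding G_def u_def
      using grad_y_perturbed_lipschitz[of x ys y r] assms by (intro mult_right_mono) auto
    finally have "\<alpha> * ((G y - G ys) \<bullet> e) \<le> \<alpha> * (((L + r) * norm u) * norm e)"
      using assms(2) by (intro mult_left_mono) auto
    also have "\<dots> = (\<alpha> * (L + r)) * (norm u * norm e)"
      by simp
    also have "\<dots> \<le> 1 / 4 * (norm u * norm e)"
      using \<alpha>L by (rule mult_right_mono) simp
    finally show ?thesis .
  qed
  moreover have "- (e \<bullet> u) \<le> norm u * norm e"
    using norm_cauchy_schwarz[of "- e" u] by (simp add: mult.commute)
  moreover have "(norm e)\<^sup>2 \<ge> 0"
    by simp
  \<comment> \<open>The factor 5/4 is 1 from Cauchy-Schwarz for \<open>e \<bullet> u\<close> plus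
    1/4 from \<open>\<alpha> * (L + r) \<le> 1 / 4\<close>.\<close>
  ultimately have "\<alpha> * r * (norm u)\<^sup>2 \<le> 5 / 4 * (norm u * norm e)"
    using 2 by argo
  then have "norm u * (\<alpha> * r * norm u) \<le> norm u * (5 / 4 * norm e)"
    by (simp add: power2_eq_square algebra_simps)
  then have "\<alpha> * r * norm u \<le> 5 / 4 * norm e"
    by (cases "u = 0") auto
  then show ?thesis
    using assms(1,2) by (simp add: u_def e_def field_simps)
qed

subsection \<open>Descent and telescoping\<close>

text \<open>Keeping only the part \<open>3 * r\<close> of the denominator and cancelling
  \<open>r\<close> gives \<open>3 * c * L \<le> 1\<close>. This lets smoothness terms be absorbed by
  terms with \<open>1 / c\<close>.\<close>

lemma L_le_inverse_c:
  assumes "r > 0" "0 < c" "c \<le> r / (L * (3 * r + 2 * L))"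
  shows "L \<le> 1 / (3 * c)"
proof -
  have "c * (L * (3 * r + 2 * L)) \<le> r"
    using assms L_pos by (simp add: pos_le_divide_eq)
  moreover have "c * (L * (2 * L)) \<ge> 0"
    using assms L_pos by simp
  ultimately have "r * (3 * c * L) \<le> r * 1"
    by (simp add: algebra_simps)
  then have "3 * c * L \<le> 1"
    using assms(1) by (simp only: mult_le_cancel_left_pos)
  then show ?thesis
    using assms(2) by (simp add: field_simps)
qed

lemma L_add_r_le_inverse_alpha:
  assumes "r > 0" "0 < \<alpha>" "\<alpha> \<le> 1 / (4 * (L + r))"
  shows "L + r \<le> 1 / (4 * \<alpha>)"
  using assms L_pos by (simp add: field_simps)

text \<open>Subtracting the lower bound for \<open>g x' y'\<close> from twice the upper bound for
  \<open>\<Phi> x'\<close> leaves the linear term \<open>Gx \<bullet> d\<close>, which the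
  projection makes at most \<open>- (norm d)\<^sup>2 / c\<close>, and twice the gradient error
  caused by \<open>y\<close> not being the inner maximizer. The error bound controls this error by
  the dual step.\<close>

lemma Psi1_descent:
  assumes "r > 0" "0 < \<alpha>" "\<alpha> \<le> 1 / (4 * (L + r))"
    and c: "0 < c" "c \<le> r\<^sup>2 * \<alpha> / (16 * L\<^sup>2)" "c \<le> r / (L * (3 * r + 2 * L))"
    and "x \<in> X" "y \<in> Y"
    and x': "x' = closest_point X (x - c *\<^sub>R grad_x f x y)"
    and y': "y' = closest_point Y (y + \<alpha> *\<^sub>R (grad_y f x' y - r *\<^sub>R y))"
  shows "Psi1 f Y r x' y' + (norm (x' - x))\<^sup>2 / (8 * c) + (norm (y' - y))\<^sup>2 / (2 * \<alpha>) \<le> Psi1 f Y r x y"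
proof -
  define g where "g = perturbed f r"
  define \<Phi> where "\<Phi> x = (SUP y\<in>Y. g x y)" for x
  define d e where "d = x' - x" and "e = y' - y"
  define A where "A = L * norm d / r"
  define Gx Gy where "Gx = grad_x f x y" and "Gy = grad_y f x' y - r *\<^sub>R y"
  have x'X: "x' \<in> X"
    unfolding x' using X_closed X_nonempty by (rule closest_point_in_set)
  have y'Y: "y' \<in> Y"
    unfolding y' using Y_closed Y_nonempty by (rule closest_point_in_set)
  \<comment> \<open>The maximizer is taken at the new point \<open>x'\<close>, where the ascent step
    evaluates its gradient, so that the error bound applies. As \<open>ys\<close> is also a
    candidate at \<open>x\<close>, it yields an upper bound for \<open>\<Phi> x'\<close> in terms of
    \<open>\<Phi> x\<close>.\<close>
  obtain ys where ys: "ys \<in> Y" "\<Phi> x' = g x' ys" "\<And>y. y \<in> Y \<Longrightarrow> g x' y \<le> g x' ys"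
    unfolding \<Phi>_def g_def using SUP_perturbed_attained[of r x'] by metis
  have K: "\<Phi> x' \<le> \<Phi> x + grad_x f x ys \<bullet> d + L / 2 * (norm d)\<^sup>2"
    using perturbed_upper_bound_fst[OF assms(7) x'X ys(1), of r] perturbed_le_SUP[OF ys(1), of r x] ys(2)
    by (simp add: \<Phi>_def g_def d_def)
  have B: "g x' y \<ge> g x y + Gx \<bullet> d - L / 2 * (norm d)\<^sup>2"
    unfolding g_def d_def Gx_def using perturbed_lower_bound_fst[OF assms(7) x'X assms(8)] .
  have C: "g x' y' \<ge> g x' y + Gy \<bullet> e - (L + r) / 2 * (norm e)\<^sup>2"
    unfolding g_def e_def Gy_def using perturbed_lower_bound_snd[OF x'X assms(8) y'Y] assms(1) by simp
  have "(x - c *\<^sub>R Gx - x') \<bullet> (x - x') \<le> 0"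
    unfolding x' Gx_def using closest_point_dot[OF X_convex X_closed assms(7)] .
  then have "(norm d)\<^sup>2 + c * (Gx \<bullet> d) \<le> 0"
    by (simp add: d_def power2_norm_eq_inner algebra_simps inner_commute)
  then have D: "Gx \<bullet> d \<le> - ((norm d)\<^sup>2 / c)"
    using c(1) by (simp add: field_simps)
  have "(y + \<alpha> *\<^sub>R Gy - y') \<bullet> (y - y') \<le> 0"
    unfolding y' Gy_def using closest_point_dot[OF Y_convex Y_closed assms(8)] .
  then have "(norm e)\<^sup>2 \<le> \<alpha> * (Gy \<bullet> e)"
    by (simp add: e_def power2_norm_eq_inner algebra_simps inner_commute)
  then have E: "(norm e)\<^sup>2 / \<alpha> \<le> Gy \<bullet> e"
    using assms(2) by (simp add: field_simps)
  have "norm (ys - y) \<le> 5 / (4 * (\<alpha> * r)) * norm e"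
    using projected_step_error_bound[OF assms(1-3) x'X assms(8) ys(1) _ y'] ys(3)
    by (simp add: e_def g_def norm_minus_commute)
  then have ys_y: "L * norm (ys - y) \<le> L * (5 / (4 * (\<alpha> * r)) * norm e)"
    using L_pos by (intro mult_left_mono) auto
  have "(grad_x f x ys - Gx) \<bullet> d \<le> norm (grad_x f x ys - Gx) * norm d"
    by (rule norm_cauchy_schwarz)
  also have "\<dots> \<le> (L * norm (ys - y)) * norm d"
    unfolding Gx_def using grad_x_smooth[of x x ys y] assms ys by (intro mult_right_mono) auto
  also have "\<dots> \<le> (L * (5 / (4 * (\<alpha> * r)) * norm e)) * norm d"
    using ys_y by (rule mult_right_mono) simp
  finally have F: "2 * ((grad_x f x ys - Gx) \<bullet> d) \<le> 5 / 2 * (A * norm e / \<alpha>)"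
    using assms(1,2) by (simp add: A_def field_simps)
  \<comment> \<open>This is where the bound \<open>r\<^sup>2 * \<alpha> / (16 * L\<^sup>2)\<close>
    on \<open>c\<close> enters: it lets the descent in \<open>x\<close> pay for the square of the
    error factor \<open>A\<close>.\<close>
  have "16 * A\<^sup>2 / \<alpha> \<le> (norm d)\<^sup>2 / c"
  proof -
    have "16 * L\<^sup>2 * c \<le> r\<^sup>2 * \<alpha>"
      using c(2) L_pos by (simp add: field_simps)
    then have "16 * L\<^sup>2 * c * (norm d)\<^sup>2 \<le> r\<^sup>2 * \<alpha> * (norm d)\<^sup>2"
      by (rule mult_right_mono) simp
    then show ?thesis
      using assms(1,2) c(1) by (simp add: A_def field_simps power_mult_distrib power_divide)
  qed
  moreover have "8 * (A * norm e / \<alpha>) \<le> 16 * A\<^sup>2 / \<alpha> + (norm e)\<^sup>2 / \<alpha>"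
  proof -
    have "0 \<le> (4 * A - norm e)\<^sup>2"
      by simp
    then have "8 * (A * norm e) \<le> 16 * A\<^sup>2 + (norm e)\<^sup>2"
      by (simp add: power2_diff power_mult_distrib)
    then have "8 * (A * norm e) / \<alpha> \<le> (16 * A\<^sup>2 + (norm e)\<^sup>2) / \<alpha>"
      using assms(2) by (simp add: divide_right_mono)
    then show ?thesis
      by (simp add: add_divide_distrib)
  qed
  ultimately have H: "5 / 2 * (A * norm e / \<alpha>) \<le> 5 / 16 * ((norm d)\<^sup>2 / c + (norm e)\<^sup>2 / \<alpha>)"
    by argo
  have "L \<le> 1 / (3 * c)"
    using assms(1) c(1,3) by (rule L_le_inverse_c)
  then have "L * (norm d)\<^sup>2 \<le> 1 / (3 * c) * (norm d)\<^sup>2"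
    by (rule mult_right_mono) simp
  then have I: "3 / 2 * L * (norm d)\<^sup>2 \<le> 1 / 2 * ((norm d)\<^sup>2 / c)"
    by simp
  have "L + r \<le> 1 / (4 * \<alpha>)"
    using assms(1-3) by (rule L_add_r_le_inverse_alpha)
  then have "(L + r) * (norm e)\<^sup>2 \<le> 1 / (4 * \<alpha>) * (norm e)\<^sup>2"
    by (rule mult_right_mono) simp
  then have J: "(L + r) / 2 * (norm e)\<^sup>2 \<le> 1 / 8 * ((norm e)\<^sup>2 / \<alpha>)"
    by simp
  have "(norm d)\<^sup>2 / c \<ge> 0" "(norm e)\<^sup>2 / \<alpha> \<ge> 0"
    using c(1) assms(2) by auto
  moreover have "(grad_x f x ys - Gx) \<bullet> d = grad_x f x ys \<bullet> d - Gx \<bullet> d"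
    by (rule inner_diff_left)
  \<comment> \<open>The coefficient of \<open>(norm d)\<^sup>2 / c\<close> is at most -1 + 1/2 +
    5/16 = -3/16, and that of \<open>(norm e)\<^sup>2 / \<alpha>\<close> is at most -1 + 1/8 + 5/16
    = -9/16; the claim asks for -1/8 and -1/2.\<close>
  ultimately have "2 * \<Phi> x' - g x' y' + 1 / 8 * ((norm d)\<^sup>2 / c) + 1 / 2 * ((norm e)\<^sup>2 / \<alpha>) \<le> 2 * \<Phi> x - g x y"
    using K B C D E F H I J by argo
  then show ?thesis
    by (simp add: Psi1_def \<Phi>_def g_def d_def e_def)
qed

end

text \<open>With constant regularization a single Lyapunov function serves all iterations, so its
  decreases telescope. The step sizes may still vary with the index.\<close>

locale perturbed_gda_run = minimax_problem f X Y L
  for f :: "'a::euclidean_space \<Rightarrow> 'b::euclidean_space \<Rightarrow> real" and X Y L +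
  fixes r :: real and \<alpha> c :: "nat \<Rightarrow> real" and x :: "nat \<Rightarrow> 'a" and y :: "nat \<Rightarrow> 'b"
    and a1 a2 b1 b2 :: real
  assumes parameters: "gda_parameters a1 a2 b1 b2 L (\<lambda>_. r) \<alpha> c"
    and iteration: "perturbed_gda f X Y (\<lambda>_. r) \<alpha> c x y"
    and gap: "finite_gap f X Y r"
    and a1_pos: "a1 > 0" and b1_pos: "b1 > 0"
begin

lemma r_pos: "r > 0"
  and alpha_pos: "0 < \<alpha> t" and alpha_le: "\<alpha> t \<le> 1 / (4 * (L + r))"
  and alpha_ge: "a1 / L \<le> \<alpha> t"
  and c_pos: "0 < c t" and c_le1: "c t \<le> r\<^sup>2 * \<alpha> t / (16 * L\<^sup>2)"
  and c_le2: "c t \<le> r / (L * (3 * r + 2 * L))"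
  and c_ge: "b1 * r\<^sup>2 / L ^ 3 \<le> c t"
  using parameters by (auto simp: gda_parameters_def theta_with_def)

lemma x_Suc: "x (Suc t) = closest_point X (x t - c t *\<^sub>R grad_x f (x t) (y t))"
  and y_Suc: "y (Suc t) = closest_point Y (y t + \<alpha> t *\<^sub>R (grad_y f (x (Suc t)) (y t) - r *\<^sub>R y t))"
  using iteration by (auto simp: perturbed_gda_def)

lemma x_mem: "x t \<in> X"
  by (cases t) (use iteration in \<open>auto simp: perturbed_gda_def X_closed X_nonempty closest_point_in_set\<close>)

lemma y_mem: "y t \<in> Y"
  by (cases t) (use iteration in \<open>auto simp: perturbed_gda_def Y_closed Y_nonempty closest_point_in_set\<close>)

lemma norm_Y_diff: "u \<in> Y \<Longrightarrow> v \<in> Y \<Longrightarrow> norm (u - v) \<le> diameter Y"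
  using diameter_bounded_bound[OF compact_imp_bounded[OF Y_compact]] by (simp add: dist_norm)

lemma norm_Y: "u \<in> Y \<Longrightarrow> norm u \<le> diameter Y"
  using norm_Y_diff[of u 0] Y_zero by simp

text \<open>The step divided by the step size is the norm of the projected gradient mapping, the
  scale on which stationarity residuals are measured.\<close>

definition step_x :: "nat \<Rightarrow> real" where
  "step_x t = norm (x (Suc t) - x t) / c t"

definition step_y :: "nat \<Rightarrow> real" where
  "step_y t = norm (y (Suc t) - y t) / \<alpha> t"

lemma step_nonneg [simp]: "step_x t \<ge> 0" "step_y t \<ge> 0"
  using c_pos[of t] alpha_pos[of t] by (simp_all add: step_x_def step_y_def)

abbreviation "gap0 \<equiv> initial_gap f X Y r (x 0) (y 0)"

lemma Psi1_decrease:
  "Psi1 f Y r (x (Suc t)) (y (Suc t)) + c t * (step_x t)\<^sup>2 / 8 + \<alpha> t * (step_y t)\<^sup>2 / 2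
    \<le> Psi1 f Y r (x t) (y t)"
  using Psi1_descent[OF r_pos alpha_pos alpha_le c_pos c_le1 c_le2 x_mem y_mem x_Suc y_Suc, of t]
    c_pos[of t] alpha_pos[of t]
  by (simp add: step_x_def step_y_def power_divide power2_eq_square)

lemma sum_steps_le: "(\<Sum>t<T. c t * (step_x t)\<^sup>2 / 8 + \<alpha> t * (step_y t)\<^sup>2 / 2) \<le> gap0"
proof -
  have "(\<Sum>t<T. c t * (step_x t)\<^sup>2 / 8 + \<alpha> t * (step_y t)\<^sup>2 / 2)
      \<le> (\<Sum>t<T. Psi1 f Y r (x t) (y t) - Psi1 f Y r (x (Suc t)) (y (Suc t)))"
    using Psi1_decrease by (intro sum_mono) (simp add: algebra_simps)
  also have "\<dots> = Psi1 f Y r (x 0) (y 0) - Psi1 f Y r (x T) (y T)"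
    by (rule sum_lessThan_telescope')
  also have "\<dots> \<le> gap0"
  proof -
    \<comment> \<open>Finiteness of the gap makes the infimum a genuine lower bound. Moreover
      \<open>Psi1\<close> lies above the maximum in \<open>y\<close>, since it adds to that maximum
      the nonnegative inner gap.\<close>
    have "(INF x\<in>X. SUP y\<in>Y. perturbed f r x y) \<le> (SUP y'\<in>Y. perturbed f r (x T) y')"
      using gap x_mem unfolding finite_gap_def by (intro cINF_lower)
    also have "\<dots> \<le> Psi1 f Y r (x T) (y T)"
      using perturbed_le_SUP[OF y_mem, of r "x T" T] by (simp add: Psi1_def)
    finally show ?thesis
      by (simp add: initial_gap_def)
  qed
  finally show ?thesis .
qed

lemma exists_small_step:
  assumes "q > 0"
  obtains t where "real t \<le> gap0 / q" "c t * (step_x t)\<^sup>2 / 8 + \<alpha> t * (step_y t)\<^sup>2 / 2 \<le> q"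
proof -
  \<comment> \<open>\<open>T\<close> exceeds \<open>gap0 / q\<close>, so not all of the first
    \<open>T\<close> decreases can be larger than \<open>q\<close>; and every \<open>t < T\<close>
    is at most \<open>T - 1\<close>, hence at most \<open>gap0 / q\<close> without an additive
    constant.\<close>
  define T where "T = Suc (nat \<lfloor>gap0 / q\<rfloor>)"
  have "gap0 \<ge> 0"
    using sum_steps_le[of 0] by simp
  then have T: "real T > gap0 / q" "real T \<le> gap0 / q + 1"
    using assms unfolding T_def by (simp; linarith)+
  have "\<exists>t<T. c t * (step_x t)\<^sup>2 / 8 + \<alpha> t * (step_y t)\<^sup>2 / 2 \<le> q"
  proof (rule ccontr)
    assume "\<not> ?thesis"
    then have "(\<Sum>t<T. q) \<le> (\<Sum>t<T. c t * (step_x t)\<^sup>2 / 8 + \<alpha> t * (step_y t)\<^sup>2 / 2)"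
      by (intro sum_mono) force
    also have "\<dots> \<le> gap0"
      by (rule sum_steps_le)
    finally show False
      using T(1) assms by (simp add: field_simps)
  qed
  then obtain t where "t < T" "c t * (step_x t)\<^sup>2 / 8 + \<alpha> t * (step_y t)\<^sup>2 / 2 \<le> q"
    by blast
  then show thesis
    using T(2) by (intro that[of t]) auto
qed

text \<open>The lower bound \<open>a1 / L\<close> and the upper bound
  \<open>1 / (4 * (L + r))\<close> on the same step size are compatible only if \<open>r\<close> is
  at most a multiple of \<open>L\<close>.\<close>

lemma r_le: "4 * a1 * r \<le> L"
proof -
  have "a1 / L \<le> 1 / (4 * (L + r))"
    using alpha_ge alpha_le order_trans by blast
  then have "4 * a1 * r + 4 * a1 * L \<le> L"
    using L_pos r_pos by (simp add: field_simps)
  moreover have "4 * a1 * L > 0"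
    using a1_pos L_pos by simp
  ultimately show ?thesis
    by linarith
qed

text \<open>In both regimes the regularization is of size \<open>\<rho> * L\<close>, with \<open>\<rho> = \<epsilon> / (L * diameter Y)\<close> for
  game stationarity and \<open>\<rho> = (\<epsilon> / (L * diameter Y))\<^sup>2\<close> for optimization stationarity.\<close>

lemma exists_small_residuals:
  assumes "C > 0" "\<rho> > 0" "\<epsilon> > 0" "k > 0" "k * \<rho> * L \<le> r"
  obtains t where "real t \<le> C * (L * gap0 / (\<rho>\<^sup>2 * \<epsilon>\<^sup>2))"
    "(step_x t)\<^sup>2 \<le> 8 * \<epsilon>\<^sup>2 / (C * b1 * k\<^sup>2)" "(step_y t)\<^sup>2 \<le> 2 * \<rho>\<^sup>2 * \<epsilon>\<^sup>2 / (C * a1)"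
proof -
  \<comment> \<open>With this \<open>q\<close> the index bound \<open>gap0 / q\<close> is the
    claimed one. The lower bounds \<open>b1 * (k * \<rho>)\<^sup>2 / L\<close> on \<open>c t\<close>
    and \<open>a1 / L\<close> on \<open>\<alpha> t\<close> then turn the total decrease into
    separate bounds on the two steps.\<close>
  define q where "q = \<rho>\<^sup>2 * \<epsilon>\<^sup>2 / (C * L)"
  have "q > 0"
    using assms L_pos by (simp add: q_def)
  then obtain t where t: "real t \<le> gap0 / q" "c t * (step_x t)\<^sup>2 / 8 + \<alpha> t * (step_y t)\<^sup>2 / 2 \<le> q"
    by (rule exists_small_step)
  have nonneg: "c t * (step_x t)\<^sup>2 \<ge> 0" "\<alpha> t * (step_y t)\<^sup>2 \<ge> 0"
    using c_pos[of t] alpha_pos[of t] by simp_all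
  have "b1 * (k * \<rho> * L)\<^sup>2 / L ^ 3 \<le> b1 * r\<^sup>2 / L ^ 3"
    using assms b1_pos L_pos by (intro divide_right_mono mult_left_mono power_mono) auto
  then have "b1 * (k * \<rho>)\<^sup>2 / L \<le> c t"
    using c_ge[of t] L_pos by (simp add: power_mult_distrib power2_eq_square power3_eq_cube)
  then have "b1 * (k * \<rho>)\<^sup>2 / L * (step_x t)\<^sup>2 \<le> c t * (step_x t)\<^sup>2"
    by (rule mult_right_mono) simp
  also have "\<dots> \<le> 8 * q"
    using t(2) nonneg by simp
  finally have "(step_x t)\<^sup>2 \<le> 8 * \<epsilon>\<^sup>2 / (C * b1 * k\<^sup>2)"
    using assms L_pos b1_pos by (simp add: q_def field_simps power_mult_distrib)
  moreover have "a1 / L * (step_y t)\<^sup>2 \<le> \<alpha> t * (step_y t)\<^sup>2"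
    using alpha_ge by (rule mult_right_mono) simp
  then have "a1 / L * (step_y t)\<^sup>2 \<le> 2 * q"
    using t(2) nonneg by simp
  then have "(step_y t)\<^sup>2 \<le> 2 * \<rho>\<^sup>2 * \<epsilon>\<^sup>2 / (C * a1)"
    using assms L_pos a1_pos by (simp add: q_def field_simps)
  moreover have "gap0 / q = C * (L * gap0 / (\<rho>\<^sup>2 * \<epsilon>\<^sup>2))"
    by (simp add: q_def)
  ultimately show thesis
    using t(1) that by metis
qed

section \<open>Stationarity residuals of one iteration\<close>

text \<open>The projection displacement divided by \<open>c t\<close> is a normal vector at the new
  point. Adding the new gradient leaves the step itself and a change of gradient, bounded through
  \<open>L \<le> 1 / (3 * c t)\<close> and \<open>L \<le> 1 / (4 * \<alpha> t)\<close>.\<close>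

lemma x_residual:
  obtains v where "\<And>z. z \<in> X \<Longrightarrow> v \<bullet> (z - x (Suc t)) \<le> 0"
    "norm (grad_x f (x (Suc t)) (y (Suc t)) + v) \<le> 4 / 3 * step_x t + 1 / 4 * step_y t"
proof -
  define d e where "d = x (Suc t) - x t" and "e = y (Suc t) - y t"
  define v where "v = (1 / c t) *\<^sub>R (x t - c t *\<^sub>R grad_x f (x t) (y t) - x (Suc t))"
  have v1: "v \<bullet> (z - x (Suc t)) \<le> 0" if "z \<in> X" for z
    using closest_point_dot[OF X_convex X_closed that, of "x t - c t *\<^sub>R grad_x f (x t) (y t)"] c_pos[of t]
    unfolding v_def x_Suc[symmetric] by (simp add: divide_nonpos_pos)
  have L_c: "L \<le> 1 / 3 * (1 / c t)"
    using L_le_inverse_c[OF r_pos c_pos c_le2, of t] by simp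
  have L_\<alpha>: "L \<le> 1 / 4 * (1 / \<alpha> t)"
    using L_add_r_le_inverse_alpha[OF r_pos alpha_pos alpha_le, of t] r_pos by simp
  have "grad_x f (x (Suc t)) (y (Suc t)) + v =
      (grad_x f (x (Suc t)) (y (Suc t)) - grad_x f (x t) (y t)) - (1 / c t) *\<^sub>R d"
    using c_pos[of t] by (simp add: v_def d_def algebra_simps)
  also have "norm \<dots> \<le> norm (grad_x f (x (Suc t)) (y (Suc t)) - grad_x f (x t) (y t)) + norm ((1 / c t) *\<^sub>R d)"
    by (rule norm_triangle_ineq4)
  also have "\<dots> \<le> L * (norm d + norm e) + step_x t"
    using grad_x_smooth[of "x (Suc t)" "x t" "y (Suc t)" "y t"] x_mem y_mem c_pos[of t]
    by (simp add: step_x_def d_def e_def)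
  also have "\<dots> \<le> 1 / 3 * (1 / c t) * norm d + 1 / 4 * (1 / \<alpha> t) * norm e + step_x t"
    using mult_right_mono[OF L_c, of "norm d"] mult_right_mono[OF L_\<alpha>, of "norm e"]
    by (simp add: distrib_left)
  also have "\<dots> = 4 / 3 * step_x t + 1 / 4 * step_y t"
    by (simp add: step_x_def step_y_def d_def e_def)
  finally show thesis
    using that v1 by blast
qed

text \<open>The normal vector comes from the regularized ascent step, so
  \<open>r *\<^sub>R y t\<close> remains as a perturbation. Its norm is at most
  \<open>r * diameter Y\<close> because \<open>0\<close> lies in \<open>Y\<close>.\<close>

lemma y_residual:
  obtains v where "\<And>z. z \<in> Y \<Longrightarrow> v \<bullet> (z - y (Suc t)) \<le> 0"
    "norm (- grad_y f (x (Suc t)) (y (Suc t)) + v) \<le> 5 / 4 * step_y t + r * diameter Y"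
proof -
  define e where "e = y (Suc t) - y t"
  define G where "G = grad_y f (x (Suc t)) (y t) - r *\<^sub>R y t"
  define v where "v = (1 / \<alpha> t) *\<^sub>R (y t + \<alpha> t *\<^sub>R G - y (Suc t))"
  have v1: "v \<bullet> (z - y (Suc t)) \<le> 0" if "z \<in> Y" for z
    using closest_point_dot[OF Y_convex Y_closed that, of "y t + \<alpha> t *\<^sub>R G"] alpha_pos[of t]
    unfolding v_def G_def y_Suc[symmetric] by (simp add: divide_nonpos_pos)
  have L_\<alpha>: "L \<le> 1 / 4 * (1 / \<alpha> t)"
    using L_add_r_le_inverse_alpha[OF r_pos alpha_pos alpha_le, of t] r_pos by simp
  have "- grad_y f (x (Suc t)) (y (Suc t)) + v =
      (grad_y f (x (Suc t)) (y t) - grad_y f (x (Suc t)) (y (Suc t))) - (1 / \<alpha> t) *\<^sub>R e - r *\<^sub>R y t"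
    using alpha_pos[of t] by (simp add: v_def e_def G_def algebra_simps)
  also have "norm \<dots> \<le> norm (grad_y f (x (Suc t)) (y t) - grad_y f (x (Suc t)) (y (Suc t)))
      + norm ((1 / \<alpha> t) *\<^sub>R e) + norm (r *\<^sub>R y t)"
    by (meson add_right_mono norm_triangle_ineq4 order_trans)
  also have "\<dots> \<le> L * norm e + step_y t + r * diameter Y"
  proof (intro add_mono)
    show "norm (grad_y f (x (Suc t)) (y t) - grad_y f (x (Suc t)) (y (Suc t))) \<le> L * norm e"
      using grad_y_smooth[of "x (Suc t)" "x (Suc t)" "y t" "y (Suc t)"] x_mem y_mem
      by (simp add: e_def norm_minus_commute)
    show "norm ((1 / \<alpha> t) *\<^sub>R e) \<le> step_y t"
      using alpha_pos[of t] by (simp add: step_y_def e_def)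
    show "norm (r *\<^sub>R y t) \<le> r * diameter Y"
      using norm_Y[OF y_mem, of t] r_pos by simp
  qed
  also have "\<dots> \<le> 1 / 4 * (1 / \<alpha> t) * norm e + step_y t + r * diameter Y"
    using mult_right_mono[OF L_\<alpha>, of "norm e"] by simp
  also have "\<dots> = 5 / 4 * step_y t + r * diameter Y"
    by (simp add: step_y_def e_def)
  finally show thesis
    using that v1 by blast
qed

lemma game_stationaryI:
  assumes "4 / 3 * step_x t + 1 / 4 * step_y t \<le> \<epsilon>" "5 / 4 * step_y t + r * diameter Y \<le> \<epsilon>"
  shows "game_stationary f X Y \<epsilon> (x (Suc t)) (y (Suc t))"
proof -
  obtain v w where v: "\<And>z. z \<in> X \<Longrightarrow> v \<bullet> (z - x (Suc t)) \<le> 0"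
      "norm (grad_x f (x (Suc t)) (y (Suc t)) + v) \<le> 4 / 3 * step_x t + 1 / 4 * step_y t"
    and w: "\<And>z. z \<in> Y \<Longrightarrow> w \<bullet> (z - y (Suc t)) \<le> 0"
      "norm (- grad_y f (x (Suc t)) (y (Suc t)) + w) \<le> 5 / 4 * step_y t + r * diameter Y"
    by (metis x_residual y_residual)
  show ?thesis
    unfolding game_stationary_def
    using infdist_normal_cone_le[OF x_mem v(1)] infdist_normal_cone_le[OF y_mem w(1)] v(2) w(2) assms
    by (meson order_trans x_mem y_mem)
qed

end

subsection \<open>The proximal point\<close>

lemma midpoint_mem:
  assumes "convex S" "u \<in> S" "v \<in> S"
  shows "midpoint u v \<in> S"
  using convexD[OF assms, of "1 / 2" "1 / 2"] by (simp add: midpoint_def scaleR_add_right)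

context minimax_problem
begin

lemma SUP_attained:
  obtains y where "y \<in> Y" "(SUP y\<in>Y. f x y) = f x y"
  using SUP_perturbed_attained[of 0 x] by (metis perturbed_zero)

lemma le_SUP: "y \<in> Y \<Longrightarrow> f x y \<le> (SUP y\<in>Y. f x y)"
  using perturbed_le_SUP[of y 0 x] by simp

text \<open>By uniform continuity on \<open>K \<times> Y\<close>, the maximizer at one point is
  nearly as good at a nearby point, and the roles of the two points can be exchanged.\<close>

lemma continuous_on_SUP:
  assumes "compact K"
  shows "continuous_on K (\<lambda>x. SUP y\<in>Y. f x y)"
  unfolding continuous_on_iff
proof (intro ballI allI impI)
  fix x and e :: real assume x: "x \<in> K" and e: "0 < e"
  have "uniformly_continuous_on (K \<times> Y) (\<lambda>(x, y). f x y)"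
    using assms Y_compact by (intro compact_uniformly_continuous continuous_joint compact_Times)
  then obtain d where d: "d > 0"
      "\<And>p q. \<lbrakk>p \<in> K \<times> Y; q \<in> K \<times> Y; dist q p < d\<rbrakk> \<Longrightarrow>
        dist (case q of (x, y) \<Rightarrow> f x y) (case p of (x, y) \<Rightarrow> f x y) < e"
    using e unfolding uniformly_continuous_on_def by metis
  have less: "(SUP y\<in>Y. f u y) < (SUP y\<in>Y. f v y) + e" if uv: "u \<in> K" "v \<in> K" "dist u v < d" for u v
  proof -
    obtain y where y: "y \<in> Y" "(SUP y\<in>Y. f u y) = f u y"
      by (rule SUP_attained)
    have "dist (f u y) (f v y) < e"
      using d(2)[of "(v, y)" "(u, y)"] uv y by (simp add: dist_Pair_Pair)
    then have "f u y < f v y + e"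
      by (simp add: dist_real_def)
    with le_SUP[OF y(1), of v] y(2) show ?thesis
      by linarith
  qed
  show "\<exists>d>0. \<forall>x'\<in>K. dist x' x < d \<longrightarrow> dist (SUP y\<in>Y. f x' y) (SUP y\<in>Y. f x y) < e"
  proof (intro exI[of _ d] conjI ballI impI)
    fix x' assume "x' \<in> K" "dist x' x < d"
    then show "dist (SUP y\<in>Y. f x' y) (SUP y\<in>Y. f x y) < e"
      using less[of x x'] less[of x' x] x by (simp add: dist_real_def dist_commute abs_less_iff)
  qed (rule d(1))
qed

text \<open>The proximal objective for the parameter \<open>1 / (2 * L)\<close> without the
  indicator function, kept real-valued so that continuity and compactness arguments apply on
  \<open>X\<close>.\<close>

definition prox_objective :: "'a \<Rightarrow> 'a \<Rightarrow> real" where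
  "prox_objective x w = (SUP y\<in>Y. f w y) + L * (norm (w - x))\<^sup>2"

text \<open>Smoothness bounds \<open>f u y0\<close> below by a linear term minus half of the
  proximal quadratic. The objective is therefore coercive on \<open>X\<close>, and minimizing over a
  large ball suffices.\<close>

lemma prox_objective_attains_min:
  assumes "x \<in> X"
  obtains w where "w \<in> X" "\<And>u. u \<in> X \<Longrightarrow> prox_objective x w \<le> prox_objective x u"
proof -
  obtain y0 where y0: "y0 \<in> Y"
    using Y_nonempty by blast
  define G where "G = norm (grad_x f x y0)"
  define M where "M = prox_objective x x - f x y0"
  \<comment> \<open>Beyond this radius \<open>L / 2 * s - G\<close> is at least 1 and
    \<open>s\<close> exceeds \<open>M\<close>, so the objective is larger than at
    \<open>x\<close>.\<close>
  define R where "R = 2 * (G + 1) / L + M"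
  have M: "M \<ge> 0"
    using le_SUP[OF y0] by (simp add: M_def prox_objective_def)
  have R: "R \<ge> 2 * (G + 1) / L" "R \<ge> M" "R \<ge> 0"
    using M L_pos by (simp_all add: R_def G_def)
  have outside: "prox_objective x x < prox_objective x u" if u: "u \<in> X" "norm (u - x) > R" for u
  proof -
    define s where "s = norm (u - x)"
    have "f u y0 \<ge> f x y0 + grad_x f x y0 \<bullet> (u - x) - L / 2 * s\<^sup>2"
      using perturbed_lower_bound_fst[OF assms u(1) y0, of 0] by (simp add: s_def)
    moreover have "grad_x f x y0 \<bullet> (u - x) \<ge> - (G * s)"
      using norm_cauchy_schwarz[of "- grad_x f x y0" "u - x"] by (simp add: G_def s_def)
    ultimately have 1: "prox_objective x u \<ge> f x y0 + s * (L / 2 * s - G)"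
      using le_SUP[OF y0, of u] by (simp add: prox_objective_def s_def power2_eq_square algebra_simps)
    have "s \<ge> 2 * (G + 1) / L"
      using R(1) u(2) by (simp add: s_def)
    then have "L / 2 * s - G \<ge> 1"
      using L_pos by (simp add: field_simps)
    then have "s * (L / 2 * s - G) \<ge> s * 1"
      using R(3) u(2) unfolding s_def by (intro mult_left_mono) auto
    with 1 R(2) u(2) show ?thesis
      by (simp add: M_def s_def)
  qed
  have K: "compact (X \<inter> cball x R)" "X \<inter> cball x R \<noteq> {}"
    using X_closed assms R(3) by (auto simp: closed_Int_compact)
  have "continuous_on (X \<inter> cball x R) (prox_objective x)"
    unfolding prox_objective_def by (intro continuous_intros continuous_on_SUP K)
  then obtain w where w: "w \<in> X \<inter> cball x R" "\<forall>u\<in>X \<inter> cball x R. prox_objective x w \<le> prox_objective x u"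
    using continuous_attains_inf[OF K] by blast
  show thesis
  proof
    show "w \<in> X"
      using w by blast
    have "x \<in> X \<inter> cball x R"
      using assms R(3) by simp
    then have wx: "prox_objective x w \<le> prox_objective x x"
      using w(2) by blast
    fix u assume u: "u \<in> X"
    show "prox_objective x w \<le> prox_objective x u"
    proof (cases "norm (u - x) \<le> R")
      case True
      then show ?thesis
        using w(2) u by (simp add: dist_norm norm_minus_commute)
    next
      case False
      then show ?thesis
        using outside[OF u] wx by simp
    qed
  qed
qed

text \<open>\<open>prox\<close> is a choice by \<open>arg_min\<close>, so an existing minimizer is
  what ensures that the chosen point is one; it lies in \<open>X\<close> since the extended
  objective is infinite elsewhere.\<close>

lemma prox_minimizes:
  assumes "x \<in> X"
  defines "w \<equiv> prox (1 / (2 * L)) (primal f X Y) x"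
  shows "w \<in> X" "u \<in> X \<Longrightarrow> prox_objective x w \<le> prox_objective x u"
proof -
  define F where "F w = primal f X Y w + ereal ((norm (w - x))\<^sup>2 / (2 * (1 / (2 * L))))" for w
  have F: "F w = (if w \<in> X then ereal (prox_objective x w) else \<infinity>)" for w
    using L_pos by (simp add: F_def primal_def indicator_fun_def prox_objective_def mult.commute)
  obtain v where v: "v \<in> X" "\<And>u. u \<in> X \<Longrightarrow> prox_objective x v \<le> prox_objective x u"
    using prox_objective_attains_min[OF assms(1)] by blast
  have w: "w = arg_min F (\<lambda>_. True)"
    unfolding w_def prox_def F_def ..
  have min: "\<forall>u. \<not> F u < F w"
    unfolding w
  proof (rule arg_minI[of "\<lambda>_. True" v])
    show "\<not> F u < F v" for u
      using v by (simp add: F not_less)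
  qed simp_all
  have "\<not> F v < F w"
    using min by blast
  then show "w \<in> X"
    using v(1) by (auto simp: F split: if_splits)
  then show "prox_objective x w \<le> prox_objective x u" if "u \<in> X"
    using min[rule_format, of u] that by (simp add: F not_less)
qed

text \<open>Weak convexity of the primal function in midpoint form. At a \<open>y\<close> maximizing
  at the midpoint, the linear terms of the two lower bounds cancel.\<close>

lemma SUP_midpoint_le:
  assumes "x \<in> X" "w \<in> X"
  shows "(SUP y\<in>Y. f (midpoint x w) y) \<le>
    ((SUP y\<in>Y. f x y) + (SUP y\<in>Y. f w y)) / 2 + L / 8 * (norm (w - x))\<^sup>2"
proof -
  define u where "u = midpoint x w"
  have u: "u \<in> X"
    unfolding u_def using midpoint_mem[OF X_convex assms] .
  obtain y where y: "y \<in> Y" "(SUP y\<in>Y. f u y) = f u y"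
    by (rule SUP_attained)
  have xu: "x - u = (1 / 2) *\<^sub>R (x - w)" and wu: "w - u = - ((1 / 2) *\<^sub>R (x - w))"
    by (simp_all add: u_def midpoint_def algebra_simps flip: scaleR_add_left)
  have "f x y \<ge> f u y + grad_x f u y \<bullet> (x - u) - L / 2 * (norm (x - u))\<^sup>2"
    "f w y \<ge> f u y + grad_x f u y \<bullet> (w - u) - L / 2 * (norm (w - u))\<^sup>2"
    using perturbed_lower_bound_fst[OF u _ y(1), of _ 0] assms by simp_all
  then have "2 * f u y \<le> f x y + f w y + L / 4 * (norm (w - x))\<^sup>2"
    unfolding xu wu by (simp add: power_divide norm_minus_commute)
  with le_SUP[OF y(1), of x] le_SUP[OF y(1), of w] y(2) show ?thesis
    unfolding u_def[symmetric] by argo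
qed

text \<open>Minimality of the proximal point forces \<open>\<Phi> x - \<Phi> w\<close> to grow like
  the square of the distance, while small residuals at \<open>(x, y)\<close> keep this difference
  small.\<close>

lemma optimization_stationaryI:
  assumes "\<epsilon> > 0" and xX: "x \<in> X" and yY: "y \<in> Y"
    and gx: "\<And>w. w \<in> X \<Longrightarrow> grad_x f x y \<bullet> (w - x) \<ge> - (\<epsilon> / 8 * norm (w - x))"
    and gy: "\<And>y'. y' \<in> Y \<Longrightarrow> f x y' \<le> f x y + \<epsilon>\<^sup>2 / (8 * L)"
  shows "optimization_stationary f X Y L \<epsilon> x"
proof -
  define \<Phi> where "\<Phi> x = (SUP y\<in>Y. f x y)" for x
  define w where "w = prox (1 / (2 * L)) (primal f X Y) x"
  define s where "s = norm (w - x)"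
  have wX: "w \<in> X" and min: "\<And>u. u \<in> X \<Longrightarrow> prox_objective x w \<le> prox_objective x u"
    unfolding w_def using prox_minimizes[OF xX] by auto
  have m: "midpoint x w \<in> X"
    using midpoint_mem[OF X_convex xX wX] .
  have nm: "norm (midpoint x w - x) = s / 2"
    using dist_midpoint(1)[of x w] by (simp add: s_def dist_norm norm_minus_commute)
  \<comment> \<open>Comparing the proximal point with the midpoint towards \<open>x\<close>, and not
    with \<open>x\<close> itself, combines the quadratic penalty with weak convexity and raises the
    growth constant from 1 to 5/4.\<close>
  have "\<Phi> w + L * s\<^sup>2 \<le> \<Phi> (midpoint x w) + L * s\<^sup>2 / 4"
    using min[OF m] unfolding prox_objective_def nm s_def[symmetric] \<Phi>_def[symmetric]
    by (simp add: power_divide)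
  then have 1: "\<Phi> x - \<Phi> w \<ge> 5 / 4 * (L * s\<^sup>2)"
    using SUP_midpoint_le[OF xX wX] unfolding s_def[symmetric] \<Phi>_def[symmetric] by argo
  have "\<Phi> x \<le> f x y + \<epsilon>\<^sup>2 / (8 * L)"
    unfolding \<Phi>_def using gy Y_nonempty by (intro cSUP_least)
  moreover have "\<Phi> w \<ge> f w y"
    unfolding \<Phi>_def using le_SUP[OF yY] .
  moreover have "f w y \<ge> f x y + grad_x f x y \<bullet> (w - x) - L / 2 * s\<^sup>2"
    using perturbed_lower_bound_fst[OF xX wX yY, of 0] by (simp add: s_def)
  moreover have "grad_x f x y \<bullet> (w - x) \<ge> - (\<epsilon> / 8 * s)"
    unfolding s_def using gx[OF wX] .
  ultimately have 2: "3 / 4 * (L * s\<^sup>2) \<le> \<epsilon>\<^sup>2 / (8 * L) + \<epsilon> / 8 * s"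
    using 1 by argo
  have "s \<le> \<epsilon> / (2 * L)"
  proof (rule ccontr)
    assume "\<not> ?thesis"
    \<comment> \<open>If \<open>s\<close> exceeded \<open>\<epsilon> / (2 * L)\<close>, the two
      error terms would be below 1/2 and at most 1/4 of \<open>L * s\<^sup>2\<close>, contradicting
      the factor 3/4.\<close>
    then have *: "\<epsilon> < 2 * (L * s)"
      using L_pos by (simp add: field_simps)
    then have "\<epsilon> * \<epsilon> < (2 * (L * s)) * (2 * (L * s))"
      using assms(1) by (intro mult_strict_mono) auto
    then have "\<epsilon>\<^sup>2 / (8 * L) < 1 / 2 * (L * s\<^sup>2)"
      using L_pos by (simp add: field_simps power2_eq_square)
    moreover have "s \<ge> 0"
      by (simp add: s_def)
    with * have "\<epsilon> / 8 * s \<le> 1 / 4 * (L * s\<^sup>2)"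
      using mult_right_mono[of \<epsilon> "2 * (L * s)" s] by (simp add: power2_eq_square)
    ultimately show False
      using 2 by argo
  qed
  then show ?thesis
    using xX by (simp add: optimization_stationary_def s_def w_def)
qed

end

section \<open>Iteration bounds with explicit constants\<close>

text \<open>The summands are the least constants that yield, in this order,
  \<open>step_x t \<le> \<epsilon> / 16\<close>, \<open>step_y t \<le> \<epsilon> / 6\<close> and
  \<open>(step_y t)\<^sup>2 \<le> \<rho> * \<epsilon>\<^sup>2 / 400\<close>, given
  \<open>4 * a1 * k * \<rho> \<le> 1\<close>.\<close>

definition rate :: "real \<Rightarrow> real \<Rightarrow> real \<Rightarrow> real" where
  "rate a1 b1 k = 2048 / (b1 * k\<^sup>2) + 9 / (2 * a1 ^ 3 * k\<^sup>2) + 200 / (a1\<^sup>2 * k)"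

lemma rate_pos: "\<lbrakk>a1 > 0; b1 > 0; k > 0\<rbrakk> \<Longrightarrow> rate a1 b1 k > 0"
  unfolding rate_def by (intro add_pos_pos) auto

context perturbed_gda_run
begin

text \<open>The normal vectors have nonpositive inner product with feasible directions, so
  Cauchy-Schwarz turns the residuals into the two variational bounds; in \<open>y\<close>, concavity
  and the diameter convert the residual into a duality gap.\<close>

lemma optimization_stationary_iterate:
  assumes "\<epsilon> > 0" and sx: "4 / 3 * step_x t + 1 / 4 * step_y t \<le> \<epsilon> / 8"
    and sy: "(5 / 4 * step_y t + r * diameter Y) * diameter Y \<le> \<epsilon>\<^sup>2 / (8 * L)"
  shows "optimization_stationary f X Y L \<epsilon> (x (Suc t))"
proof (rule optimization_stationaryI[OF assms(1) x_mem y_mem])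
  let ?x = "x (Suc t)" and ?y = "y (Suc t)"
  fix w assume w: "w \<in> X"
  obtain v where v: "\<And>z. z \<in> X \<Longrightarrow> v \<bullet> (z - ?x) \<le> 0"
      "norm (grad_x f ?x ?y + v) \<le> 4 / 3 * step_x t + 1 / 4 * step_y t"
    using x_residual by blast
  have "- (grad_x f ?x ?y + v) \<bullet> (w - ?x) \<le> norm (grad_x f ?x ?y + v) * norm (w - ?x)"
    using norm_cauchy_schwarz[of "- (grad_x f ?x ?y + v)" "w - ?x"] by (simp only: norm_minus_cancel)
  also have "\<dots> \<le> \<epsilon> / 8 * norm (w - ?x)"
    using v(2) sx by (intro mult_right_mono) auto
  finally show "grad_x f ?x ?y \<bullet> (w - ?x) \<ge> - (\<epsilon> / 8 * norm (w - ?x))"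
    using v(1)[OF w] by (simp add: inner_add_left inner_diff_left)
next
  let ?x = "x (Suc t)" and ?y = "y (Suc t)"
  fix y' assume y': "y' \<in> Y"
  obtain v where v: "\<And>z. z \<in> Y \<Longrightarrow> v \<bullet> (z - ?y) \<le> 0"
      "norm (- grad_y f ?x ?y + v) \<le> 5 / 4 * step_y t + r * diameter Y"
    using y_residual by blast
  have "f ?x y' \<le> f ?x ?y + grad_y f ?x ?y \<bullet> (y' - ?y)"
    unfolding grad_y_def by (rule concave_on_le_tangent[OF f_concave[OF x_mem] y_mem y' differentiable_snd])
  moreover have "- (- grad_y f ?x ?y + v) \<bullet> (y' - ?y) \<le> norm (- grad_y f ?x ?y + v) * norm (y' - ?y)"
    using norm_cauchy_schwarz[of "- (- grad_y f ?x ?y + v)" "y' - ?y"] by (simp only: norm_minus_cancel)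
  moreover have "norm (- grad_y f ?x ?y + v) * norm (y' - ?y) \<le> (5 / 4 * step_y t + r * diameter Y) * diameter Y"
    using v(2) norm_Y_diff[OF y' y_mem] Y_diameter r_pos by (intro mult_mono) auto
  ultimately show "f ?x y' \<le> f ?x ?y + \<epsilon>\<^sup>2 / (8 * L)"
    using v(1)[OF y'] sy by (simp add: inner_add_left inner_diff_left)
qed

lemma exists_small_steps:
  assumes "\<rho> > 0" "\<epsilon> > 0" "k > 0" "k * \<rho> * L \<le> r"
  obtains t where "real t \<le> rate a1 b1 k * (L * gap0 / (\<rho>\<^sup>2 * \<epsilon>\<^sup>2))"
    "step_x t \<le> \<epsilon> / 16" "step_y t \<le> \<epsilon> / 6" "(step_y t)\<^sup>2 \<le> \<rho> * \<epsilon>\<^sup>2 / 400"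
proof -
  have parts: "2048 / (b1 * k\<^sup>2) > 0" "9 / (2 * a1 ^ 3 * k\<^sup>2) > 0" "200 / (a1\<^sup>2 * k) > 0"
    using a1_pos b1_pos assms by simp_all
  have C: "rate a1 b1 k > 0" "rate a1 b1 k \<ge> 2048 / (b1 * k\<^sup>2)" "rate a1 b1 k \<ge> 9 / (2 * a1 ^ 3 * k\<^sup>2)" "rate a1 b1 k \<ge> 200 / (a1\<^sup>2 * k)"
    unfolding rate_def using parts by linarith+
  obtain t where t: "real t \<le> rate a1 b1 k * (L * gap0 / (\<rho>\<^sup>2 * \<epsilon>\<^sup>2))"
    "(step_x t)\<^sup>2 \<le> 8 * \<epsilon>\<^sup>2 / (rate a1 b1 k * b1 * k\<^sup>2)" "(step_y t)\<^sup>2 \<le> 2 * \<rho>\<^sup>2 * \<epsilon>\<^sup>2 / (rate a1 b1 k * a1)"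
    using exists_small_residuals[OF C(1) assms] by blast
  have "4 * a1 * (k * \<rho> * L) \<le> 4 * a1 * r"
    using assms(4) a1_pos by simp
  also have "\<dots> \<le> L"
    by (rule r_le)
  finally have "L * (4 * a1 * k * \<rho>) \<le> L * 1"
    by (simp add: algebra_simps)
  then have \<rho>: "4 * a1 * k * \<rho> \<le> 1"
    using L_pos by (simp only: mult_le_cancel_left_pos)
  have "8 / (rate a1 b1 k * b1 * k\<^sup>2) \<le> 1 / 256"
    using C(1,2) b1_pos assms(3) by (simp add: field_simps)
  then have "8 / (rate a1 b1 k * b1 * k\<^sup>2) * \<epsilon>\<^sup>2 \<le> 1 / 256 * \<epsilon>\<^sup>2"
    by (rule mult_right_mono) simp
  then have "(step_x t)\<^sup>2 \<le> (\<epsilon> / 16)\<^sup>2"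
    using t(2) by (simp add: power_divide)
  then have X: "step_x t \<le> \<epsilon> / 16"
    by (rule power2_le_imp_le) (use assms in simp)
  \<comment> \<open>Only one of the two factors \<open>\<rho>\<close> is spent against
    \<open>4 * a1 * k * \<rho> \<le> 1\<close>; the other survives in the bound that optimization
    stationarity relies on. For the bound by \<open>\<epsilon> / 6\<close> both are spent.\<close>
  have ratio: "2 * \<rho> / (rate a1 b1 k * a1) \<le> 1 / 400"
  proof -
    have "200 \<le> rate a1 b1 k * (a1\<^sup>2 * k)"
      using C(4) a1_pos assms(3) by (simp add: field_simps)
    then have "200 * (4 * \<rho>) \<le> (rate a1 b1 k * (a1\<^sup>2 * k)) * (4 * \<rho>)"
      using assms(1) by (intro mult_right_mono) auto
    also have "\<dots> = (rate a1 b1 k * a1) * (4 * a1 * k * \<rho>)"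
      by (simp add: power2_eq_square)
    also have "\<dots> \<le> (rate a1 b1 k * a1) * 1"
      using \<rho> C(1) a1_pos by (intro mult_left_mono) auto
    finally show ?thesis
      using C(1) a1_pos by (simp add: field_simps)
  qed
  have "(step_y t)\<^sup>2 \<le> 2 * \<rho> / (rate a1 b1 k * a1) * (\<rho> * \<epsilon>\<^sup>2)"
    using t(3) by (simp add: power2_eq_square mult_ac)
  also have "\<dots> \<le> 1 / 400 * (\<rho> * \<epsilon>\<^sup>2)"
    using ratio assms(1) by (intro mult_right_mono) auto
  finally have Y2: "(step_y t)\<^sup>2 \<le> \<rho> * \<epsilon>\<^sup>2 / 400"
    by simp
  have "2 * \<rho>\<^sup>2 / (rate a1 b1 k * a1) \<le> 1 / 36"
  proof -
    have "9 \<le> rate a1 b1 k * (2 * a1 ^ 3 * k\<^sup>2)"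
      using C(3) a1_pos assms(3) by (simp add: field_simps)
    then have "9 * (8 * \<rho>\<^sup>2) \<le> (rate a1 b1 k * (2 * a1 ^ 3 * k\<^sup>2)) * (8 * \<rho>\<^sup>2)"
      by (intro mult_right_mono) auto
    also have "\<dots> = (rate a1 b1 k * a1) * (4 * a1 * k * \<rho>)\<^sup>2"
      by (simp add: power2_eq_square power3_eq_cube)
    also have "\<dots> \<le> (rate a1 b1 k * a1) * 1\<^sup>2"
      using \<rho> C(1) a1_pos assms by (intro mult_left_mono power_mono) auto
    finally show ?thesis
      using C(1) a1_pos by (simp add: field_simps)
  qed
  then have "2 * \<rho>\<^sup>2 / (rate a1 b1 k * a1) * \<epsilon>\<^sup>2 \<le> 1 / 36 * \<epsilon>\<^sup>2"
    by (rule mult_right_mono) simp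
  then have "(step_y t)\<^sup>2 \<le> (\<epsilon> / 6)\<^sup>2"
    using t(3) by (simp add: power_divide)
  then have Y: "step_y t \<le> \<epsilon> / 6"
    by (rule power2_le_imp_le) (use assms in simp)
  show thesis
    using t(1) X Y Y2 by (rule that)
qed

lemma game_stationary_rate:
  assumes "\<epsilon> > 0" "k1 > 0" "k2 \<le> 1 / 2" "theta_with k1 k2 r (\<epsilon> / diameter Y)"
  shows "\<exists>t. real t \<le> rate a1 b1 k1 * (L ^ 3 * (diameter Y)\<^sup>2 * gap0 / \<epsilon> ^ 4) \<and>
    game_stationary f X Y \<epsilon> (x (Suc t)) (y (Suc t))"
proof -
  define D where "D = diameter Y"
  have D: "D > 0"
    using Y_diameter by (simp add: D_def)
  define \<rho> where "\<rho> = \<epsilon> / (L * D)"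
  have "\<rho> > 0" "k1 * \<rho> * L \<le> r"
    using assms D L_pos by (simp_all add: \<rho>_def theta_with_def D_def field_simps)
  then obtain t where t: "real t \<le> rate a1 b1 k1 * (L * gap0 / (\<rho>\<^sup>2 * \<epsilon>\<^sup>2))" "step_x t \<le> \<epsilon> / 16" "step_y t \<le> \<epsilon> / 6"
    using exists_small_steps assms(1,2) by metis
  have "r \<le> k2 * (\<epsilon> / D)"
    using assms(4) by (simp add: theta_with_def D_def)
  also have "\<dots> \<le> 1 / 2 * (\<epsilon> / D)"
    using assms(1,3) D by (intro mult_right_mono) auto
  finally have "r * diameter Y \<le> \<epsilon> / 2"
    using D by (simp add: D_def field_simps)
  \<comment> \<open>The primal residual is at most (1/12 + 1/24) \<open>\<epsilon>\<close>, and the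
    dual one at most (5/24 + 1/2) \<open>\<epsilon>\<close>.\<close>
  then have "game_stationary f X Y \<epsilon> (x (Suc t)) (y (Suc t))"
    using t assms(1) by (intro game_stationaryI) auto
  moreover have "L * gap0 / (\<rho>\<^sup>2 * \<epsilon>\<^sup>2) = L ^ 3 * D\<^sup>2 * gap0 / \<epsilon> ^ 4"
    using L_pos D assms(1) by (simp add: \<rho>_def field_simps power2_eq_square eval_nat_numeral)
  ultimately show ?thesis
    using t(1) by (auto simp: D_def)
qed

text \<open>The duality gap budget \<open>\<epsilon>\<^sup>2 / (8 * L)\<close> is split evenly
  between the dual step and the regularization, which is why \<open>k2\<close> is at most
  1/16.\<close>

lemma optimization_stationary_rate:
  assumes "\<epsilon> > 0" "k1 > 0" "k2 \<le> 1 / 16" "theta_with k1 k2 r (\<epsilon>\<^sup>2 / (L * (diameter Y)\<^sup>2))"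
  shows "\<exists>t. real t \<le> rate a1 b1 k1 * (L ^ 5 * (diameter Y) ^ 4 * gap0 / \<epsilon> ^ 6) \<and>
    optimization_stationary f X Y L \<epsilon> (x (Suc t))"
proof -
  define D where "D = diameter Y"
  have D: "D > 0"
    using Y_diameter by (simp add: D_def)
  define \<rho> where "\<rho> = (\<epsilon> / (L * D))\<^sup>2"
  have \<rho>L: "\<rho> * L = \<epsilon>\<^sup>2 / (L * D\<^sup>2)"
    using D L_pos by (simp add: \<rho>_def power2_eq_square field_simps)
  have "\<rho> > 0" "k1 * \<rho> * L \<le> r"
    using assms D L_pos \<rho>L by (simp_all add: \<rho>_def theta_with_def D_def mult.assoc)
  then obtain t where t: "real t \<le> rate a1 b1 k1 * (L * gap0 / (\<rho>\<^sup>2 * \<epsilon>\<^sup>2))" "step_x t \<le> \<epsilon> / 16" "step_y t \<le> \<epsilon> / 6"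
      "(step_y t)\<^sup>2 \<le> \<rho> * \<epsilon>\<^sup>2 / 400"
    using exists_small_steps assms(1,2) by metis
  have "(step_y t)\<^sup>2 \<le> (\<epsilon>\<^sup>2 / (20 * L * D))\<^sup>2"
    using t(4) by (simp add: \<rho>_def power2_eq_square algebra_simps)
  then have "step_y t \<le> \<epsilon>\<^sup>2 / (20 * L * D)"
    by (rule power2_le_imp_le) (use D L_pos in simp)
  then have 1: "5 / 4 * step_y t * D \<le> \<epsilon>\<^sup>2 / (16 * L)"
    using D L_pos by (simp add: field_simps)
  have "r \<le> k2 * (\<epsilon>\<^sup>2 / (L * D\<^sup>2))"
    using assms(4) by (simp add: theta_with_def D_def)
  also have "\<dots> \<le> 1 / 16 * (\<epsilon>\<^sup>2 / (L * D\<^sup>2))"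
    using assms(1,3) D L_pos by (intro mult_right_mono) auto
  finally have "r * D * D \<le> \<epsilon>\<^sup>2 / (16 * L)"
    using D L_pos by (simp add: field_simps power2_eq_square)
  with 1 have "(5 / 4 * step_y t + r * D) * D \<le> \<epsilon>\<^sup>2 / (8 * L)"
    by (simp add: distrib_right)
  then have "optimization_stationary f X Y L \<epsilon> (x (Suc t))"
    using t assms(1) by (intro optimization_stationary_iterate) (auto simp: D_def)
  moreover have "L * gap0 / (\<rho>\<^sup>2 * \<epsilon>\<^sup>2) = L ^ 5 * D ^ 4 * gap0 / \<epsilon> ^ 6"
    using L_pos D assms(1) by (simp add: \<rho>_def field_simps eval_nat_numeral)
  ultimately show ?thesis
    using t(1) by (auto simp: D_def)
qed

end

section \<open>Transfer to parameter sequences that are constant in the regularization\<close>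

lemma perturbed_gda_runI:
  assumes "minimax_problem f X Y L" "gda_parameters a1 a2 b1 b2 L r \<alpha> c"
    "perturbed_gda f X Y r \<alpha> c x y" "finite_gap f X Y (r 0)" "\<forall>t. r t = ry" "a1 > 0" "b1 > 0"
  shows "perturbed_gda_run f X Y L (r 0) \<alpha> c x y a1 a2 b1 b2"
proof -
  have "r = (\<lambda>_. r 0)"
    using assms(5) by auto
  with assms show ?thesis
    by (metis perturbed_gda_run.intro perturbed_gda_run_axioms.intro)
qed

lemma game_stationary_bound:
  assumes "minimax_problem f X Y L" "gda_parameters a1 a2 b1 b2 L r \<alpha> c"
    "perturbed_gda f X Y r \<alpha> c x y" "finite_gap f X Y (r 0)" "\<epsilon> > 0" "\<forall>t. r t = ry"
    "theta_with k1 k2 ry (\<epsilon> / diameter Y)" "a1 > 0" "b1 > 0" "k1 > 0" "k2 \<le> 1 / 16"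
  shows "\<exists>t. real t \<le> rate a1 b1 k1 * (L ^ 3 * (diameter Y)\<^sup>2 * initial_gap f X Y (r 0) (x 0) (y 0) / \<epsilon> ^ 4) \<and>
    game_stationary f X Y \<epsilon> (x (t + 1)) (y (t + 1))"
proof -
  interpret perturbed_gda_run f X Y L "r 0" \<alpha> c x y a1 a2 b1 b2
    by (rule perturbed_gda_runI[OF assms(1-4,6,8,9)])
  have "ry = r 0"
    using assms(6) by simp
  then show ?thesis
    using game_stationary_rate[of \<epsilon> k1 k2] assms by simp
qed

lemma optimization_stationary_bound:
  assumes "minimax_problem f X Y L" "gda_parameters a1 a2 b1 b2 L r \<alpha> c"
    "perturbed_gda f X Y r \<alpha> c x y" "finite_gap f X Y (r 0)" "\<epsilon> > 0" "\<forall>t. r t = ry"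
    "theta_with k1 k2 ry (\<epsilon>\<^sup>2 / (L * (diameter Y)\<^sup>2))" "a1 > 0" "b1 > 0" "k1 > 0" "k2 \<le> 1 / 16"
  shows "\<exists>t. real t \<le> rate a1 b1 k1 * (L ^ 5 * (diameter Y) ^ 4 * initial_gap f X Y (r 0) (x 0) (y 0) / \<epsilon> ^ 6) \<and>
    optimization_stationary f X Y L \<epsilon> (x (t + 1))"
proof -
  interpret perturbed_gda_run f X Y L "r 0" \<alpha> c x y a1 a2 b1 b2
    by (rule perturbed_gda_runI[OF assms(1-4,6,8,9)])
  have "ry = r 0"
    using assms(6) by simp
  then show ?thesis
    using optimization_stationary_rate[of \<epsilon> k1 k2] assms by simp
qed

text \<open>The cap \<open>\<kappa>\<close> on the upper constant of \<open>ry\<close> keeps the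
  bias of the regularization within a fixed share of the accuracy. \<open>C\<close> depends only on
  the constants quantified before it, so it is uniform in the problem data, the run and
  \<open>\<epsilon>\<close>.\<close>

theorem theorem3p1:
  shows
    "(\<exists>\<kappa>>0. \<forall>a1>0. \<forall>a2. \<forall>b1>0. \<forall>b2. \<forall>k1>0. \<forall>k2\<le>\<kappa>. \<exists>C>0.
        \<forall>(f :: real^'n \<Rightarrow> real^'d \<Rightarrow> real) X Y L r \<alpha> c x y ry \<epsilon>.
          minimax_problem f X Y L \<and>
          gda_parameters a1 a2 b1 b2 L r \<alpha> c \<and>
          perturbed_gda f X Y r \<alpha> c x y \<and>
          finite_gap f X Y (r 0) \<and>
          \<epsilon> > 0 \<and>
          (\<forall>t. r t = ry) \<and>
          theta_with k1 k2 ry (\<epsilon> / diameter Y)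
          \<longrightarrow>
          (\<exists>t. real t \<le> C * (L ^ 3 * (diameter Y)\<^sup>2 * initial_gap f X Y (r 0) (x 0) (y 0) / \<epsilon> ^ 4) \<and>
               game_stationary f X Y \<epsilon> (x (t + 1)) (y (t + 1))))
     \<and>
     (\<exists>\<kappa>>0. \<forall>a1>0. \<forall>a2. \<forall>b1>0. \<forall>b2. \<forall>k1>0. \<forall>k2\<le>\<kappa>. \<exists>C>0.
        \<forall>(f :: real^'n \<Rightarrow> real^'d \<Rightarrow> real) X Y L r \<alpha> c x y ry \<epsilon>.
          minimax_problem f X Y L \<and>
          gda_parameters a1 a2 b1 b2 L r \<alpha> c \<and>
          perturbed_gda f X Y r \<alpha> c x y \<and>
          finite_gap f X Y (r 0) \<and>
          \<epsilon> > 0 \<and>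
          (\<forall>t. r t = ry) \<and>
          theta_with k1 k2 ry (\<epsilon>\<^sup>2 / (L * (diameter Y)\<^sup>2))
          \<longrightarrow>
          (\<exists>t. real t \<le> C * (L ^ 5 * (diameter Y) ^ 4 * initial_gap f X Y (r 0) (x 0) (y 0) / \<epsilon> ^ 6) \<and>
               optimization_stationary f X Y L \<epsilon> (x (t + 1))))"
  \<comment> \<open>The value 1/16 is what the optimization part requires; it lies below the 1/2
    used in the game part.\<close>
  apply (intro conjI; rule exI[of _ "1 / 16"]; intro conjI allI impI)
  subgoal by simp
  subgoal for a1 a2 b1 b2 k1 k2
    by (rule exI[of _ "rate a1 b1 k1"]) (blast intro: rate_pos game_stationary_bound)
  subgoal by simp
  subgoal for a1 a2 b1 b2 k1 k2
    by (rule exI[of _ "rate a1 b1 k1"]) (blast intro: rate_pos optimization_stationary_bound)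
  done

end
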